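(* Let $K$ be a field of characteristic $0$, let $n\ge 1$, let $R=K[x_1,y_1,z_1,x_2,y_2,z_2,\dots,x_n,y_n,z_n]$ be a polynomial ring in $3n$ variables, and let $\Delta:R\to R$ be the derivation $$\Delta=\sum_{i=1}^n\left(x_i\frac{\partial}{\partial y_i}+y_i\frac{\partial}{\partial z_i}\right).$$ Then the algebra of constants $R^\Delta=\{h\in R\mid \Delta(h)=0\}$ is minimally generated as a $K$-algebra by the following elements: (1) $f_{(i)}:=x_i$ for $1\le i\le n$; (2) $f_{(i,j)}:=x_iy_j-x_jy_i$ for $1\le i<j\le n$; (3) $g_{(i,j)}:=x_iz_j-y_iy_j+z_ix_j$ for $1\le i\le j\le n$; (4) $g_{(i,j,k)}:=\det\begin{pmatrix}x_i&y_i&z_i\\ x_j&y_j&z_j\\ x_k&y_k&z_k\end{pmatrix}$ for $1\le i<j<k\le n$.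
   Context: "Minimally generated" means that the listed elements generate $R^\Delta$ as a $K$-algebra and that no proper subset of the listed elements generates $R^\Delta$ as a $K$-algebra. (The derivation $\Delta$ satisfies $\Delta(z_i)=y_i$, $\Delta(y_i)=x_i$, $\Delta(x_i)=0$, so on the degree-one component of $R$ it is given by a nilpotent Jordan matrix with all blocks of size 3.) *)

theory Defs
  imports "HOL-Library.Poly_Mapping" "HOL-Analysis.Determinants"
begin

(* Polynomials over 'k in variables from 'v: a monomial is its finitely supported exponent
   vector, a polynomial a finitely supported family of coefficients. Addition and
   (convolution) multiplication are those of Poly_Mapping. *)
type_synonym ('v, 'k) mpoly = "('v \<Rightarrow>\<^sub>0 nat) \<Rightarrow>\<^sub>0 'k"

definition mconst :: "'k::comm_ring_1 \<Rightarrow> ('v, 'k) mpoly" where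
  "mconst c = Poly_Mapping.single 0 c"

definition mvar :: "'v \<Rightarrow> ('v, 'k::comm_ring_1) mpoly" where
  "mvar v = Poly_Mapping.single (Poly_Mapping.single v 1) 1"

(* The polynomials in which only variables from V occur, i.e. K[V]. *)
definition poly_ring :: "'v set \<Rightarrow> ('v, 'k::comm_ring_1) mpoly set" where
  "poly_ring V = {p. \<forall>m \<in> Poly_Mapping.keys p. Poly_Mapping.keys m \<subseteq> V}"

(* Termwise, c * v^e * m' |-> (e * c) * v^(e-1) * m'. For e = 0 the truncated subtraction
   of exponents is harmless, since the coefficient is then 0. *)
definition partial_deriv :: "'v \<Rightarrow> ('v, 'k::comm_ring_1) mpoly \<Rightarrow> ('v, 'k) mpoly" where
  "partial_deriv v p = (\<Sum>m \<in> Poly_Mapping.keys p.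
     Poly_Mapping.single (m - Poly_Mapping.single v 1)
       (of_nat (Poly_Mapping.lookup m v) * Poly_Mapping.lookup p m))"

definition is_subalgebra :: "('v, 'k::comm_ring_1) mpoly set \<Rightarrow> bool" where
  "is_subalgebra A \<longleftrightarrow> (\<forall>c. mconst c \<in> A) \<and>
     (\<forall>p \<in> A. \<forall>q \<in> A. p + q \<in> A \<and> p * q \<in> A)"

definition generates :: "('v, 'k::comm_ring_1) mpoly set \<Rightarrow> ('v, 'k) mpoly set \<Rightarrow> bool" where
  "generates S A \<longleftrightarrow> is_subalgebra hull S = A"

definition minimally_generates ::
    "('v, 'k::comm_ring_1) mpoly set \<Rightarrow> ('v, 'k) mpoly set \<Rightarrow> bool" where
  "minimally_generates S A \<longleftrightarrow> generates S A \<and> (\<forall>T. T \<subset> S \<longrightarrow> \<not> generates T A)"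

datatype xyz = X nat | Y nat | Z nat

definition R :: "nat \<Rightarrow> (xyz, 'k::comm_ring_1) mpoly set" where
  "R n = poly_ring (\<Union>i \<in> {1..n}. {X i, Y i, Z i})"

abbreviation xvar :: "nat \<Rightarrow> (xyz, 'k::comm_ring_1) mpoly" where "xvar i \<equiv> mvar (X i)"
abbreviation yvar :: "nat \<Rightarrow> (xyz, 'k::comm_ring_1) mpoly" where "yvar i \<equiv> mvar (Y i)"
abbreviation zvar :: "nat \<Rightarrow> (xyz, 'k::comm_ring_1) mpoly" where "zvar i \<equiv> mvar (Z i)"

definition Delta :: "nat \<Rightarrow> (xyz, 'k::comm_ring_1) mpoly \<Rightarrow> (xyz, 'k) mpoly" where
  "Delta n p = (\<Sum>i = 1..n. xvar i * partial_deriv (Y i) p + yvar i * partial_deriv (Z i) p)"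

definition constants :: "nat \<Rightarrow> (xyz, 'k::comm_ring_1) mpoly set" where
  "constants n = {h \<in> R n. Delta n h = 0}"

definition f1 :: "nat \<Rightarrow> (xyz, 'k::comm_ring_1) mpoly" where
  "f1 i = xvar i"

definition f2 :: "nat \<Rightarrow> nat \<Rightarrow> (xyz, 'k::comm_ring_1) mpoly" where
  "f2 i j = xvar i * yvar j - xvar j * yvar i"

definition g2 :: "nat \<Rightarrow> nat \<Rightarrow> (xyz, 'k::comm_ring_1) mpoly" where
  "g2 i j = xvar i * zvar j - yvar i * yvar j + zvar i * xvar j"

definition g3 :: "nat \<Rightarrow> nat \<Rightarrow> nat \<Rightarrow> (xyz, 'k::comm_ring_1) mpoly" where
  "g3 i j k = det (vector [vector [xvar i, yvar i, zvar i],
                           vector [xvar j, yvar j, zvar j],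
                           vector [xvar k, yvar k, zvar k]] :: (xyz, 'k) mpoly ^ 3 ^ 3)"

end

theory Submission
  imports Defs
begin

text \<open>
  \<open>\<Delta>\<close> is the raising operator of an action of \<open>sl\<^sub>2\<close> on \<open>R\<close> by derivations; the lowering operator
  \<open>\<nabla>\<close> sends \<open>x\<^sub>i \<mapsto> y\<^sub>i \<mapsto> z\<^sub>i \<mapsto> 0\<close>, and \<open>H = [\<Delta>, \<nabla>]\<close> is the weight operator.

  Generation is by induction on the degree \<open>d\<close>. For a homogeneous constant \<open>h\<close>, Euler's formula writes
  \<open>d h\<close> as the sum of the \<open>x\<^sub>i a\<^sub>i + y\<^sub>i b\<^sub>i + z\<^sub>i c\<^sub>i\<close> with the partial derivatives
  \<open>a\<^sub>i, b\<^sub>i, c\<^sub>i\<close> of \<open>h\<close>, for which \<open>\<Delta> a\<^sub>i = - b\<^sub>i\<close>, \<open>\<Delta> b\<^sub>i = - c\<^sub>i\<close> and \<open>\<Delta> c\<^sub>i = 0\<close>. By the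
  Clebsch-Gordan decomposition this is a combination of transvectants of \<open>(x\<^sub>i, y\<^sub>i, z\<^sub>i)\<close> with constants of
  degree \<open>d - 1\<close>. It remains to see that the algebra generated by the listed elements is closed under
  transvectants with \<open>(x\<^sub>i, y\<^sub>i, z\<^sub>i)\<close>. The first transvectant is a derivation, and the second one is a
  differential operator of order two whose symbol is a biderivation, so that this is a finite
  computation on generators.

  Minimality: for each generator, some monomial of it has no factorization compatible with the monomials
  of the other generators, so the others lie in a subalgebra of polynomials with restricted support.
\<close>

section \<open>Derivations of polynomial rings\<close>

lemma mconst_0 [simp]: "mconst 0 = 0"
  by (simp add: mconst_def)

lemma mconst_1 [simp]: "mconst 1 = 1"
  by (simp add: mconst_def)

lemma mconst_add: "mconst (a + b) = mconst a + mconst b"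
  by (simp add: mconst_def single_add)

lemma mconst_minus: "mconst (- a) = - mconst a"
  by (simp add: mconst_def single_uminus)

lemma mconst_diff: "mconst (a - b) = mconst a - mconst b"
  by (simp add: mconst_def single_diff)

lemma mconst_mult: "mconst (a * b) = mconst a * mconst b"
  by (simp add: mconst_def mult_single)

lemma lookup_mconst_mult: "Poly_Mapping.lookup (mconst c * p) m = c * Poly_Mapping.lookup p m"
  by (simp add: mconst_def mult_map_scale_conv_mult [symmetric] Poly_Mapping.map.rep_eq when_def)

section \<open>Subalgebras and polynomial subrings\<close>

lemma is_subalgebra_poly_ring: "is_subalgebra (poly_ring V :: ('v, 'k::comm_ring_1) mpoly set)"
  unfolding is_subalgebra_def poly_ring_def
proof (intro conjI allI ballI)
  fix c :: 'k
  show "mconst c \<in> {p. \<forall>m\<in>Poly_Mapping.keys p. Poly_Mapping.keys m \<subseteq> V}"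
    by (auto simp: mconst_def split: if_splits)
next
  fix p q :: "('v, 'k) mpoly"
  assume p: "p \<in> {p. \<forall>m\<in>Poly_Mapping.keys p. Poly_Mapping.keys m \<subseteq> V}"
    and q: "q \<in> {p. \<forall>m\<in>Poly_Mapping.keys p. Poly_Mapping.keys m \<subseteq> V}"
  show "p + q \<in> {p. \<forall>m\<in>Poly_Mapping.keys p. Poly_Mapping.keys m \<subseteq> V}"
    using p q Poly_Mapping.keys_add[of p q] by blast
  have "Poly_Mapping.keys m \<subseteq> V" if m: "m \<in> Poly_Mapping.keys (p * q)" for m
  proof -
    obtain a b where "a \<in> Poly_Mapping.keys p" "b \<in> Poly_Mapping.keys q" "m = a + b"
      using m keys_mult[of p q] by blast
    then show ?thesis using p q Poly_Mapping.keys_add[of a b] by blast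
  qed
  then show "p * q \<in> {p. \<forall>m\<in>Poly_Mapping.keys p. Poly_Mapping.keys m \<subseteq> V}" by blast
qed

lemma mvar_in_poly_ring: "v \<in> V \<Longrightarrow> mvar v \<in> poly_ring V"
  by (auto simp: mvar_def poly_ring_def split: if_splits)

lemma is_subalgebraD:
  assumes "is_subalgebra A"
  shows "mconst c \<in> A" "0 \<in> A" "1 \<in> A"
    and "p \<in> A \<Longrightarrow> q \<in> A \<Longrightarrow> p + q \<in> A" "p \<in> A \<Longrightarrow> q \<in> A \<Longrightarrow> p * q \<in> A"
    and "p \<in> A \<Longrightarrow> - p \<in> A" "p \<in> A \<Longrightarrow> q \<in> A \<Longrightarrow> p - q \<in> A"
    and "(\<And>i. i \<in> I \<Longrightarrow> f i \<in> A) \<Longrightarrow> sum f I \<in> A"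
proof -
  show c: "mconst c \<in> A" for c using assms by (simp add: is_subalgebra_def)
  show add: "p + q \<in> A" if "p \<in> A" "q \<in> A" for p q
    using assms that by (simp add: is_subalgebra_def)
  show mult: "p * q \<in> A" if "p \<in> A" "q \<in> A" for p q
    using assms that by (simp add: is_subalgebra_def)
  show 0: "0 \<in> A" using c[of 0] by simp
  show "1 \<in> A" using c[of 1] by simp
  show neg: "- p \<in> A" if "p \<in> A" for p
    using mult[OF c[of "-1"] that] by (simp add: mconst_minus)
  show "p - q \<in> A" if "p \<in> A" "q \<in> A" for p q
    using add[OF that(1) neg[OF that(2)]] by simp
  show "(\<And>i. i \<in> I \<Longrightarrow> f i \<in> A) \<Longrightarrow> sum f I \<in> A"
    by (induction I rule: infinite_finite_induct) (auto intro: add 0)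
qed

lemma is_subalgebraI:
  assumes "\<And>c. mconst c \<in> A" "\<And>p q. p \<in> A \<Longrightarrow> q \<in> A \<Longrightarrow> p + q \<in> A"
    "\<And>p q. p \<in> A \<Longrightarrow> q \<in> A \<Longrightarrow> p * q \<in> A"
  shows "is_subalgebra A"
  using assms by (simp add: is_subalgebra_def)

lemma is_subalgebra_hull: "is_subalgebra (is_subalgebra hull S)"
  by (rule hull_in) (fastforce simp: is_subalgebra_def)

lemma poly_mapping_sum_single:
  "p = (\<Sum>m \<in> Poly_Mapping.keys p. Poly_Mapping.single m (Poly_Mapping.lookup p m))"
  by (rule poly_mapping_eqI)
     (auto simp: lookup_sum lookup_single when_def in_keys_iff)

lemma mpoly_induct [case_names single add]:
  fixes p :: "'a \<Rightarrow>\<^sub>0 'b::comm_monoid_add"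
  assumes single: "\<And>m c. P (Poly_Mapping.single m c)"
    and add: "\<And>p q. P p \<Longrightarrow> P q \<Longrightarrow> P (p + q)"
  shows "P p"
proof -
  have "P (\<Sum>m \<in> M. Poly_Mapping.single m (Poly_Mapping.lookup p m))" if "finite M" for M
    using that by (induction M) (auto intro: add single simp: single[of undefined 0, simplified])
  from this[of "Poly_Mapping.keys p"] show ?thesis
    by (simp flip: poly_mapping_sum_single)
qed

lemma single_in_subalgebra:
  fixes A :: "('v, 'k::comm_ring_1) mpoly set"
  assumes A: "is_subalgebra A" and V: "\<And>v. v \<in> Poly_Mapping.keys m \<Longrightarrow> mvar v \<in> A"
  shows "Poly_Mapping.single m c \<in> A"
proof -
  have "Poly_Mapping.single (\<Sum>v\<in>S. Poly_Mapping.single v (Poly_Mapping.lookup m v)) 1 \<in> A"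
    if "finite S" "S \<subseteq> Poly_Mapping.keys m" for S
    using that
  proof (induction S)
    case empty
    then show ?case using is_subalgebraD(3)[OF A] by simp
  next
    case (insert v S)
    have "Poly_Mapping.single (Poly_Mapping.single v k) 1 \<in> A" for k
    proof (induction k)
      case 0
      then show ?case using is_subalgebraD(3)[OF A] by simp
    next
      case (Suc k)
      have "Poly_Mapping.single (Poly_Mapping.single v (Suc k)) 1
          = (mvar v * Poly_Mapping.single (Poly_Mapping.single v k) 1 :: ('v, 'k) mpoly)"
        by (simp add: mvar_def mult_single single_add [symmetric])
      then show ?case using is_subalgebraD(5)[OF A V Suc] insert by auto
    qed
    from is_subalgebraD(5)[OF A this insert.IH] insert show ?case
      by (simp add: mult_single)
  qed
  from this[of "Poly_Mapping.keys m"] have "Poly_Mapping.single m 1 \<in> A"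
    by (simp flip: poly_mapping_sum_single)
  from is_subalgebraD(5)[OF A is_subalgebraD(1)[OF A, of c] this] show ?thesis
    by (simp add: mconst_def mult_single)
qed

text \<open>Serves as an induction principle on \<open>K[V]\<close>: for \<open>A\<close> one takes
  the set of polynomials with the property to be proved.\<close>

lemma poly_ring_subset_subalgebra:
  fixes A :: "('v, 'k::comm_ring_1) mpoly set"
  assumes A: "is_subalgebra A" and V: "\<And>v. v \<in> V \<Longrightarrow> mvar v \<in> A"
  shows "poly_ring V \<subseteq> A"
proof
  fix p :: "('v, 'k) mpoly" assume p: "p \<in> poly_ring V"
  have "(\<Sum>m \<in> Poly_Mapping.keys p. Poly_Mapping.single m (Poly_Mapping.lookup p m)) \<in> A"
    using p by (intro is_subalgebraD(8)[OF A] single_in_subalgebra[OF A] V)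
      (auto simp: poly_ring_def)
  then show "p \<in> A" by (simp flip: poly_mapping_sum_single)
qed

section \<open>Derivations\<close>

definition derivation :: "(('v, 'k::comm_ring_1) mpoly \<Rightarrow> ('v, 'k) mpoly) \<Rightarrow> bool" where
  "derivation D \<longleftrightarrow> (\<forall>p q. D (p + q) = D p + D q) \<and>
     (\<forall>p q. D (p * q) = D p * q + p * D q) \<and> (\<forall>c. D (mconst c) = 0)"

lemma derivationD:
  assumes "derivation D"
  shows "D (p + q) = D p + D q" "D (p * q) = D p * q + p * D q" "D (mconst c) = 0"
    "D 0 = 0" "D 1 = 0" "D (- p) = - D p" "D (p - q) = D p - D q"
    "D (mconst c * p) = mconst c * D p" "D (sum f I) = (\<Sum>i\<in>I. D (f i))"
proof -
  show add: "D (p + q) = D p + D q" for p q using assms by (simp add: derivation_def)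
  show mult: "D (p * q) = D p * q + p * D q" for p q using assms by (simp add: derivation_def)
  show c: "D (mconst c) = 0" for c using assms by (simp add: derivation_def)
  show smult: "D (mconst c * p) = mconst c * D p" for c p by (simp add: mult c)
  show 0: "D 0 = 0" using c[of 0] by simp
  show "D 1 = 0" using c[of 1] by simp
  show neg: "D (- p) = - D p" for p using smult[of "-1" p] by (simp add: mconst_minus)
  show "D (p - q) = D p - D q" using add[of p "- q"] neg[of q] by simp
  show "D (sum f I) = (\<Sum>i\<in>I. D (f i))"
    by (induction I rule: infinite_finite_induct) (simp_all add: 0 add)
qed

text \<open>The set of \<open>p\<close> satisfying the identity is a subalgebra, because a
  commutator of derivations is a derivation; once it contains the variables from \<open>V\<close>,
  it contains \<open>K[V]\<close>.\<close>

lemma derivation_commutator: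
  assumes D1: "derivation D1" and D2: "derivation D2" and D3: "derivation D3"
    and V: "\<And>v. v \<in> V \<Longrightarrow> D1 (D2 (mvar v)) = D2 (D1 (mvar v)) + D3 (mvar v)"
    and p: "p \<in> poly_ring V"
  shows "D1 (D2 p) = D2 (D1 p) + D3 p"
proof -
  let ?A = "{p. D1 (D2 p) = D2 (D1 p) + D3 p}"
  have "is_subalgebra ?A"
    unfolding is_subalgebra_def
    by (auto simp: derivationD[OF D1] derivationD[OF D2] derivationD[OF D3] algebra_simps)
  from poly_ring_subset_subalgebra[OF this, of V] V p show ?thesis by auto
qed

section \<open>Partial derivatives\<close>

lemma partial_deriv_single:
  "partial_deriv v (Poly_Mapping.single m c) =
     Poly_Mapping.single (m - Poly_Mapping.single v 1) (of_nat (Poly_Mapping.lookup m v) * c)"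
  by (cases "c = 0") (simp_all add: partial_deriv_def)

lemma partial_deriv_add: "partial_deriv v (p + q) = partial_deriv v p + partial_deriv v q"
proof -
  let ?t = "\<lambda>p m. Poly_Mapping.single (m - Poly_Mapping.single v 1)
    (of_nat (Poly_Mapping.lookup m v) * Poly_Mapping.lookup p m)"
  \<comment> \<open>Cancellation can make the support of \<open>p + q\<close> smaller than the union
    \<open>?M\<close>, so all three sums are first extended to \<open>?M\<close> by zero
    terms.\<close>
  have *: "partial_deriv v p = (\<Sum>m\<in>M. ?t p m)"
    if "finite M" "Poly_Mapping.keys p \<subseteq> M" for M p
    unfolding partial_deriv_def
    using that by (intro sum.mono_neutral_left) (auto simp: in_keys_iff)
  let ?M = "Poly_Mapping.keys p \<union> Poly_Mapping.keys q"
  have "partial_deriv v (p + q) = (\<Sum>m\<in>?M. ?t (p + q) m)"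
    using Poly_Mapping.keys_add[of p q] by (intro *) auto
  also have "\<dots> = (\<Sum>m\<in>?M. ?t p m) + (\<Sum>m\<in>?M. ?t q m)"
    by (simp add: sum.distrib [symmetric] lookup_add distrib_left single_add)
  also have "\<dots> = partial_deriv v p + partial_deriv v q"
    by (subst (1 2) *[of ?M]) auto
  finally show ?thesis .
qed

text \<open>Multiplication by \<open>v\<close> undoes the truncated subtraction of exponents, and
  where truncation occurs the coefficient is 0. Hence this operator is diagonal on
  monomials.\<close>

lemma mvar_times_partial_deriv_single:
  "mvar v * partial_deriv v (Poly_Mapping.single m c) =
     Poly_Mapping.single m (of_nat (Poly_Mapping.lookup m v) * c)"
proof (cases "Poly_Mapping.lookup m v = 0")
  case False
  then have "Poly_Mapping.single v (Suc 0) + (m - Poly_Mapping.single v (Suc 0)) = m"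
    by (intro poly_mapping_eqI) (auto simp: lookup_add lookup_minus lookup_single when_def)
  then show ?thesis by (simp add: partial_deriv_single mvar_def mult_single)
qed (simp add: partial_deriv_single)

lemma lookup_mvar_times_partial_deriv:
  "Poly_Mapping.lookup (mvar v * partial_deriv v p) m =
     of_nat (Poly_Mapping.lookup m v) * Poly_Mapping.lookup p m"
proof (induction p rule: mpoly_induct)
  case (single k c)
  then show ?case
    by (auto simp: mvar_times_partial_deriv_single lookup_single when_def simp del: One_nat_def)
qed (simp add: partial_deriv_add lookup_add distrib_left)

lemma partial_deriv_mult_single:
  "partial_deriv v (Poly_Mapping.single m c * Poly_Mapping.single k d) =
     partial_deriv v (Poly_Mapping.single m c) * Poly_Mapping.single k d +
     Poly_Mapping.single m c * partial_deriv v (Poly_Mapping.single k d)"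
proof -
  let ?e = "Poly_Mapping.single v (1::nat)"
  have 1: "Poly_Mapping.single (m - ?e + k) (of_nat (Poly_Mapping.lookup m v) * c * d)
      = Poly_Mapping.single (m + k - ?e) (of_nat (Poly_Mapping.lookup m v) * c * d)"
  proof (cases "Poly_Mapping.lookup m v = 0")
    case False
    then have "m - ?e + k = m + k - ?e"
      by (intro poly_mapping_eqI) (auto simp: lookup_add lookup_minus lookup_single when_def)
    then show ?thesis by simp
  qed simp
  have 2: "Poly_Mapping.single (m + (k - ?e)) (c * (of_nat (Poly_Mapping.lookup k v) * d))
      = Poly_Mapping.single (m + k - ?e) (c * (of_nat (Poly_Mapping.lookup k v) * d))"
  proof (cases "Poly_Mapping.lookup k v = 0")
    case False
    then have "m + (k - ?e) = m + k - ?e"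
      by (intro poly_mapping_eqI) (auto simp: lookup_add lookup_minus lookup_single when_def)
    then show ?thesis by simp
  qed simp
  show ?thesis
    unfolding partial_deriv_single mult_single 1 2 single_add [symmetric]
    by (simp add: lookup_add algebra_simps)
qed

lemma derivation_partial_deriv: "derivation (partial_deriv v)"
proof -
  have "partial_deriv v (p * q) = partial_deriv v p * q + p * partial_deriv v q"
    for p q :: "('a, 'b) mpoly"
  proof (induction p rule: mpoly_induct)
    case (single m c)
    show ?case
    proof (induction q rule: mpoly_induct)
      case (single k d)
      then show ?case by (rule partial_deriv_mult_single)
    next
      case (add q q')
      then show ?case by (simp add: partial_deriv_add algebra_simps)
    qed
  next
    case (add p p')
    then show ?case by (simp add: partial_deriv_add algebra_simps)
  qed
  then show ?thesis
    by (simp add: derivation_def partial_deriv_add) (simp add: mconst_def partial_deriv_single)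
qed

lemma partial_deriv_mvar: "partial_deriv v (mvar u) = (if u = v then 1 else 0)"
  by (simp add: mvar_def partial_deriv_single lookup_single)

lemma partial_deriv_in_poly_ring:
  assumes "p \<in> poly_ring V"
  shows "partial_deriv v p \<in> poly_ring V"
  unfolding partial_deriv_def
proof (rule is_subalgebraD(8)[OF is_subalgebra_poly_ring])
  fix m assume m: "m \<in> Poly_Mapping.keys p"
  have "Poly_Mapping.keys (m - Poly_Mapping.single v 1) \<subseteq> Poly_Mapping.keys m"
    by (auto simp: in_keys_iff lookup_minus)
  with m assms show "Poly_Mapping.single (m - Poly_Mapping.single v 1)
      (of_nat (Poly_Mapping.lookup m v) * Poly_Mapping.lookup p m) \<in> poly_ring V"
    by (auto simp: poly_ring_def)
qed

text \<open>For finite \<open>V\<close>, the derivation with value \<open>\<phi> v\<close> at each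
  \<open>v\<close> in \<open>V\<close> and value 0 at all other variables.\<close>

definition der :: "'v set \<Rightarrow> ('v \<Rightarrow> ('v, 'k::comm_ring_1) mpoly) \<Rightarrow> ('v, 'k) mpoly \<Rightarrow> ('v, 'k) mpoly" where
  "der V \<phi> p = (\<Sum>v\<in>V. \<phi> v * partial_deriv v p)"

lemma derivation_der: "derivation (der V \<phi>)"
  unfolding derivation_def der_def
  by (auto simp: derivationD[OF derivation_partial_deriv] algebra_simps sum.distrib
      sum_distrib_left)

lemma der_mvar: "finite V \<Longrightarrow> v \<in> V \<Longrightarrow> der V \<phi> (mvar v) = \<phi> v"
  by (simp add: der_def partial_deriv_mvar if_distrib cong: if_cong)

lemma der_in_poly_ring:
  assumes "\<And>v. v \<in> V \<Longrightarrow> \<phi> v \<in> poly_ring V" "p \<in> poly_ring V"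
  shows "der V \<phi> p \<in> poly_ring V"
  unfolding der_def using assms
  by (intro is_subalgebraD[OF is_subalgebra_poly_ring] partial_deriv_in_poly_ring) auto

lemma derivation_zero: "derivation (\<lambda>p. 0)"
  by (simp add: derivation_def)

lemma derivation_smult: "derivation D \<Longrightarrow> derivation (\<lambda>p. mconst c * D p)"
  by (simp add: derivation_def algebra_simps)

section \<open>The action of the Lie algebra \<open>sl\<^sub>2\<close>\<close>

definition vars :: "nat \<Rightarrow> xyz set" where
  "vars n = (\<Union>i \<in> {1..n}. {X i, Y i, Z i})"

lemma R_eq: "R n = poly_ring (vars n)"
  by (simp add: R_def vars_def)

lemma vars_simps [simp]:
  "finite (vars n)"
  "X i \<in> vars n \<longleftrightarrow> i \<in> {1..n}" "Y i \<in> vars n \<longleftrightarrow> i \<in> {1..n}" "Z i \<in> vars n \<longleftrightarrow> i \<in> {1..n}"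
  by (auto simp: vars_def)

lemma sum_vars: "(\<Sum>v\<in>vars n. f v) = (\<Sum>i=1..n. f (X i) + f (Y i) + f (Z i))"
  for f :: "xyz \<Rightarrow> 'a::comm_monoid_add"
  unfolding vars_def by (subst sum.UNION_disjoint) (auto simp: add.assoc)

lemma is_subalgebra_R: "is_subalgebra (R n)"
  by (simp add: R_def is_subalgebra_poly_ring)

lemmas R_closed = is_subalgebraD[OF is_subalgebra_R]

definition raising :: "nat \<Rightarrow> (xyz, 'k::comm_ring_1) mpoly \<Rightarrow> (xyz, 'k) mpoly" where
  "raising n = der (vars n) (\<lambda>v. case v of X i \<Rightarrow> 0 | Y i \<Rightarrow> xvar i | Z i \<Rightarrow> yvar i)"

definition lowering :: "nat \<Rightarrow> (xyz, 'k::comm_ring_1) mpoly \<Rightarrow> (xyz, 'k) mpoly" where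
  "lowering n = der (vars n) (\<lambda>v. case v of X i \<Rightarrow> yvar i | Y i \<Rightarrow> zvar i | Z i \<Rightarrow> 0)"

text \<open>Diagonal on monomials, with eigenvalue the degree in which \<open>v\<close> counts
  \<open>\<epsilon> v\<close>; see \<open>lookup_grading\<close>. The instances needed are total
  degree and weight.\<close>

definition grading :: "(xyz \<Rightarrow> int) \<Rightarrow> nat \<Rightarrow> (xyz, 'k::comm_ring_1) mpoly \<Rightarrow> (xyz, 'k) mpoly" where
  "grading \<epsilon> n = der (vars n) (\<lambda>v. mconst (of_int (\<epsilon> v)) * mvar v)"

abbreviation euler :: "nat \<Rightarrow> (xyz, 'k::comm_ring_1) mpoly \<Rightarrow> (xyz, 'k) mpoly" where
  "euler \<equiv> grading (\<lambda>v. 1)"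

text \<open>Half of the customary weights 2, 0, -2, so that \<open>[\<Delta>, \<nabla>] = H\<close>
  and \<open>[H, \<Delta>] = \<Delta>\<close> hold without factors.\<close>

definition wt_var :: "xyz \<Rightarrow> int" where
  "wt_var v = (case v of X i \<Rightarrow> 1 | Y i \<Rightarrow> 0 | Z i \<Rightarrow> - 1)"

abbreviation weight :: "nat \<Rightarrow> (xyz, 'k::comm_ring_1) mpoly \<Rightarrow> (xyz, 'k) mpoly" where
  "weight \<equiv> grading wt_var"

lemma wt_var_simps [simp]: "wt_var (X i) = 1" "wt_var (Y i) = 0" "wt_var (Z i) = - 1"
  by (simp_all add: wt_var_def)

lemma Delta_eq_raising: "Delta n = raising n"
  by (rule ext) (simp add: Delta_def raising_def der_def sum_vars)

lemma derivation_raising: "derivation (raising n)"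
  by (simp add: raising_def derivation_der)

lemma derivation_lowering: "derivation (lowering n)"
  by (simp add: lowering_def derivation_der)

lemma derivation_grading: "derivation (grading \<epsilon> n)"
  by (simp add: grading_def derivation_der)

lemmas raising = derivationD[OF derivation_raising]
lemmas lowering = derivationD[OF derivation_lowering]
lemmas grading = derivationD[OF derivation_grading]
lemmas pderiv = derivationD[OF derivation_partial_deriv]

lemma op_mvar [simp]:
  assumes "i \<in> {1..n}"
  shows "raising n (xvar i) = 0" "raising n (yvar i) = xvar i" "raising n (zvar i) = yvar i"
    "lowering n (xvar i) = yvar i" "lowering n (yvar i) = zvar i" "lowering n (zvar i) = 0"
  using assms by (simp_all add: raising_def lowering_def der_mvar)

lemma grading_mvar [simp]: "v \<in> vars n \<Longrightarrow> grading \<epsilon> n (mvar v) = mconst (of_int (\<epsilon> v)) * mvar v"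
  by (simp add: grading_def der_mvar)

lemma mvar_in_R: "v \<in> vars n \<Longrightarrow> mvar v \<in> R n"
  by (simp add: R_eq mvar_in_poly_ring)

lemma vars_cases:
  assumes "v \<in> vars n"
  obtains i where "i \<in> {1..n}" "v = X i" | i where "i \<in> {1..n}" "v = Y i"
    | i where "i \<in> {1..n}" "v = Z i"
  using assms by (cases v) auto

lemma op_in_R:
  assumes "p \<in> R n"
  shows "raising n p \<in> R n" "lowering n p \<in> R n" "grading \<epsilon> n p \<in> R n"
    "partial_deriv v p \<in> R n"
proof -
  note [simp] = mvar_in_R
  show "raising n p \<in> R n" unfolding raising_def R_eq
    by (rule der_in_poly_ring) (use assms in \<open>auto elim!: vars_cases simp flip: R_eq intro: R_closed\<close>)
  show "lowering n p \<in> R n" unfolding lowering_def R_eq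
    by (rule der_in_poly_ring) (use assms in \<open>auto elim!: vars_cases simp flip: R_eq intro: R_closed\<close>)
  show "grading \<epsilon> n p \<in> R n" unfolding grading_def R_eq
    by (rule der_in_poly_ring) (use assms in \<open>auto simp flip: R_eq intro!: R_closed\<close>)
  show "partial_deriv v p \<in> R n"
    using assms partial_deriv_in_poly_ring by (auto simp: R_eq)
qed

text \<open>Each identity is checked on the variables by \<open>derivation_commutator\<close>, with
  the zero derivation as third operator where two operators commute. By the last three, the partial
  derivatives of a constant form a chain under \<open>raising\<close>, up to sign.\<close>

lemma commutators:
  assumes p: "p \<in> R n"
  shows raising_lowering: "raising n (lowering n p) = lowering n (raising n p) + weight n p"
    and weight_raising: "weight n (raising n p) = raising n (weight n p) + raising n p"
    and weight_lowering: "weight n (lowering n p) = lowering n (weight n p) - lowering n p"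
    and euler_raising: "euler n (raising n p) = raising n (euler n p)"
    and euler_lowering: "euler n (lowering n p) = lowering n (euler n p)"
    and partial_deriv_grading: "partial_deriv v (grading \<epsilon> n p)
      = grading \<epsilon> n (partial_deriv v p) + mconst (of_int (\<epsilon> v)) * partial_deriv v p"
    and partial_deriv_X_raising: "partial_deriv (X i) (raising n p)
      = raising n (partial_deriv (X i) p) + partial_deriv (Y i) p"
    and partial_deriv_Y_raising: "partial_deriv (Y i) (raising n p)
      = raising n (partial_deriv (Y i) p) + partial_deriv (Z i) p"
    and partial_deriv_Z_raising: "partial_deriv (Z i) (raising n p)
      = raising n (partial_deriv (Z i) p)"
proof -
  note D = derivation_raising derivation_lowering derivation_grading derivation_partial_deriv
    derivation_zero derivation_smult[OF derivation_raising]
    derivation_smult[OF derivation_lowering] derivation_smult[OF derivation_partial_deriv]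
  note S = raising lowering grading pderiv mconst_minus partial_deriv_mvar
  note p' = p[unfolded R_eq]
  show "raising n (lowering n p) = lowering n (raising n p) + weight n p"
    by (rule derivation_commutator[OF D(1) D(2) D(3) _ p']) (auto elim!: vars_cases simp: S split: if_splits)
  show "weight n (raising n p) = raising n (weight n p) + raising n p"
    by (rule derivation_commutator[OF D(3) D(1) D(1) _ p']) (auto elim!: vars_cases simp: S split: if_splits)
  show "euler n (raising n p) = raising n (euler n p)"
    by (rule derivation_commutator[OF D(3) D(1) D(5) _ p', simplified add_0_right])
       (auto elim!: vars_cases simp: S split: if_splits)
  show "euler n (lowering n p) = lowering n (euler n p)"
    by (rule derivation_commutator[OF D(3) D(2) D(5) _ p', simplified add_0_right])
       (auto elim!: vars_cases simp: S split: if_splits)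
  have "weight n (lowering n p) = lowering n (weight n p) + mconst (- 1) * lowering n p"
    by (rule derivation_commutator[OF D(3) D(2) D(7) _ p']) (auto elim!: vars_cases simp: S split: if_splits)
  then show "weight n (lowering n p) = lowering n (weight n p) - lowering n p"
    by (simp add: mconst_minus)
  show "partial_deriv v (grading \<epsilon> n p)
      = grading \<epsilon> n (partial_deriv v p) + mconst (of_int (\<epsilon> v)) * partial_deriv v p"
    by (rule derivation_commutator[OF D(4) D(3) D(8) _ p']) (auto simp: S)
  show "partial_deriv (X i) (raising n p)
      = raising n (partial_deriv (X i) p) + partial_deriv (Y i) p"
    by (rule derivation_commutator[OF D(4) D(1) D(4) _ p']) (auto elim!: vars_cases simp: S split: if_splits)
  show "partial_deriv (Y i) (raising n p)
      = raising n (partial_deriv (Y i) p) + partial_deriv (Z i) p"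
    by (rule derivation_commutator[OF D(4) D(1) D(4) _ p']) (auto elim!: vars_cases simp: S split: if_splits)
  show "partial_deriv (Z i) (raising n p) = raising n (partial_deriv (Z i) p)"
    by (rule derivation_commutator[OF D(4) D(1) D(5) _ p', simplified add_0_right])
       (auto elim!: vars_cases simp: S split: if_splits)
qed

section \<open>Bigrading by degree and weight\<close>

definition grade :: "(xyz \<Rightarrow> int) \<Rightarrow> nat \<Rightarrow> (xyz \<Rightarrow>\<^sub>0 nat) \<Rightarrow> int" where
  "grade \<epsilon> n m = (\<Sum>v\<in>vars n. \<epsilon> v * int (Poly_Mapping.lookup m v))"

lemma lookup_grading:
  "Poly_Mapping.lookup (grading \<epsilon> n p) m = of_int (grade \<epsilon> n m) * Poly_Mapping.lookup p m"
  by (simp add: grading_def der_def grade_def lookup_sum mult.assoc lookup_mconst_mult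
      lookup_mvar_times_partial_deriv sum_distrib_right)

text \<open>Stated by eigenvector equations rather than by monomials: the commutators then show
  directly how \<open>raising\<close>, \<open>lowering\<close> and partial derivatives shift
  \<open>d\<close> and \<open>s\<close>.\<close>

definition bihomogeneous :: "nat \<Rightarrow> int \<Rightarrow> int \<Rightarrow> (xyz, 'k::field_char_0) mpoly \<Rightarrow> bool" where
  "bihomogeneous n d s p \<longleftrightarrow> p \<in> R n \<and> euler n p = mconst (of_int d) * p \<and>
     weight n p = mconst (of_int s) * p"

text \<open>Comparison of coefficients; in characteristic 0 different integers remain different
  eigenvalues.\<close>

lemma bihomogeneous_iff:
  "bihomogeneous n d s p \<longleftrightarrow> p \<in> R n \<and>
    (\<forall>m\<in>Poly_Mapping.keys p. grade (\<lambda>v. 1) n m = d \<and> grade wt_var n m = s)"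
proof -
  have "grading \<epsilon> n p = mconst (of_int c) * p \<longleftrightarrow> (\<forall>m\<in>Poly_Mapping.keys p. grade \<epsilon> n m = c)"
    for \<epsilon> c
    by (auto simp: poly_mapping_eq_iff fun_eq_iff lookup_grading lookup_mconst_mult in_keys_iff)
  then show ?thesis by (auto simp: bihomogeneous_def)
qed

lemma bihomogeneous_add:
  "bihomogeneous n d s p \<Longrightarrow> bihomogeneous n d s q \<Longrightarrow> bihomogeneous n d s (p + q)"
  by (simp add: bihomogeneous_def R_closed grading distrib_left)

lemma bihomogeneous_smult:
  "bihomogeneous n d s p \<Longrightarrow> bihomogeneous n d s (mconst c * p)"
  by (simp add: bihomogeneous_def R_closed grading mult.left_commute)

lemma bihomogeneous_raising:
  "bihomogeneous n d s p \<Longrightarrow> bihomogeneous n d (s + 1) (raising n p)"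
  by (simp add: bihomogeneous_def op_in_R euler_raising weight_raising raising mconst_add algebra_simps)

lemma bihomogeneous_lowering:
  "bihomogeneous n d s p \<Longrightarrow> bihomogeneous n d (s - 1) (lowering n p)"
  by (simp add: bihomogeneous_def op_in_R euler_lowering weight_lowering lowering mconst_diff algebra_simps)

lemma bihomogeneous_partial_deriv:
  assumes "bihomogeneous n d s p"
  shows "bihomogeneous n (d - 1) (s - wt_var v) (partial_deriv v p)"
proof -
  have p: "p \<in> R n" using assms by (simp add: bihomogeneous_def)
  have "grading \<epsilon> n (partial_deriv v p) = mconst (of_int (c - \<epsilon> v)) * partial_deriv v p"
    if "grading \<epsilon> n p = mconst (of_int c) * p" for \<epsilon> c
    using partial_deriv_grading[OF p, of v \<epsilon>] that by (simp add: pderiv mconst_diff algebra_simps)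
  then show ?thesis using assms by (simp add: bihomogeneous_def op_in_R del: of_int_diff)
qed

text \<open>Every variable has weight at least -1, so the weight of a monomial is at least minus its
  degree.\<close>

lemma bihomogeneous_bounds:
  assumes "bihomogeneous n d s p" "p \<noteq> 0"
  shows "0 \<le> d" "- d \<le> s"
proof -
  obtain m where m: "m \<in> Poly_Mapping.keys p" using assms(2) by (metis all_not_in_conv keys_eq_empty)
  have d: "d = grade (\<lambda>v. 1) n m" and s: "s = grade wt_var n m"
    using m assms(1) by (auto simp: bihomogeneous_iff)
  show "0 \<le> d" by (simp add: d grade_def sum_nonneg)
  have "0 \<le> (\<Sum>v\<in>vars n. (1 + wt_var v) * int (Poly_Mapping.lookup m v))"
    by (intro sum_nonneg mult_nonneg_nonneg) (auto simp: wt_var_def split: xyz.split)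
  then show "- d \<le> s" by (simp add: d s grade_def distrib_right sum.distrib)
qed

section \<open>Strings of the lowering operator\<close>

lemma mconst_mult_eq_0_iff [simp]: "mconst c * p = 0 \<longleftrightarrow> c = 0 \<or> p = 0"
  for c :: "'k::field"
proof -
  have "p = 0" if "mconst c * p = 0" "c \<noteq> 0"
  proof -
    have "mconst (inverse c) * (mconst c * p) = p"
      using that(2) by (simp add: mult.assoc [symmetric] mconst_mult [symmetric])
    then show ?thesis using that(1) by simp
  qed
  then show ?thesis by auto
qed

text \<open>Moving \<open>raising\<close> past one more \<open>lowering\<close> contributes the
  weight of the vector in between. The hypothesis is on \<open>lowering n (raising n u)\<close> so
  that the lemma also covers \<open>a1\<close> in \<open>clebsch_gordan_in_gen_alg\<close>, whose
  image under \<open>raising\<close> is not known to vanish beforehand.\<close>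

lemma raising_lowering_funpow:
  assumes u: "bihomogeneous n d s u" and 0: "lowering n (raising n u) = 0"
  shows "bihomogeneous n d (s - int k) ((lowering n ^^ k) u)"
    and "raising n ((lowering n ^^ Suc k) u) =
      mconst (of_int (\<Sum>j\<le>k. s - int j)) * (lowering n ^^ k) u"
proof -
  show b: "bihomogeneous n d (s - int k) ((lowering n ^^ k) u)" for k
  proof (induction k)
    case (Suc k)
    from bihomogeneous_lowering[OF this] show ?case by (simp add: algebra_simps)
  qed (use u in simp)
  show "raising n ((lowering n ^^ Suc k) u) =
      mconst (of_int (\<Sum>j\<le>k. s - int j)) * (lowering n ^^ k) u"
  proof (induction k)
    case 0
    then show ?case using u assms(2)
      by (simp add: raising_lowering bihomogeneous_def)
  next
    case (Suc k)
    let ?v = "(lowering n ^^ Suc k) u"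
    have v: "?v \<in> R n" "weight n ?v = mconst (of_int (s - int (Suc k))) * ?v"
      using b[of "Suc k"] by (simp_all add: bihomogeneous_def)
    have "raising n (lowering n ?v) = lowering n (raising n ?v) + weight n ?v"
      by (rule raising_lowering[OF v(1)])
    also have "\<dots> = mconst (of_int (\<Sum>j\<le>Suc k. s - int j)) * ?v"
      unfolding Suc v(2) lowering
      by (simp add: mconst_add distrib_right del: of_int_diff of_int_sum)
    finally show ?case by simp
  qed
qed

text \<open>Each step decreases the weight by one in fixed degree, while nonzero elements have
  weight at least \<open>- d\<close>; the index \<open>nat (d + s) + l + 1\<close> is past this
  bound.\<close>

lemma bihomogeneous_lowering_funpow_eq_0:
  assumes "\<And>k. bihomogeneous n d (s - int k) ((lowering n ^^ k) u)"
  shows "\<exists>k\<ge>l. (lowering n ^^ k) u = 0"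
proof (rule ccontr)
  assume "\<not> ?thesis"
  then have "- d \<le> s - int k" if "k \<ge> l" for k
    using bihomogeneous_bounds(2)[OF assms[of k]] that by blast
  from this[of "nat (d + s) + l + 1"] show False by linarith
qed

text \<open>For \<open>s < 0\<close> all factors along the string are negative integers, hence
  nonzero in characteristic 0. A nonzero \<open>u\<close> would thus have an endless string of
  nonzero images, against the weight bound.\<close>

lemma negative_weight_eq_0:
  assumes u: "bihomogeneous n d s u" and 0: "lowering n (raising n u) = 0" and s: "s < 0"
  shows "u = 0"
proof -
  note * = raising_lowering_funpow[OF u 0]
  have "(lowering n ^^ k) u \<noteq> 0" if "u \<noteq> 0" for k
  proof (induction k)
    case (Suc k)
    have "(\<Sum>j\<le>k. s - int j) < 0" using s by (induction k) auto
    then show ?case using Suc *(2)[of k] by (auto simp: raising simp del: of_int_sum)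
  qed (use that in simp)
  then show ?thesis using bihomogeneous_lowering_funpow_eq_0[OF *(1), of 0] by blast
qed

text \<open>\<open>lowering n u\<close> has weight -1 and is annihilated by \<open>raising\<close>,
  since the commutator acts on \<open>u\<close> as its weight 0.\<close>

lemma zero_weight_lowering_eq_0:
  assumes u: "bihomogeneous n d 0 u" and 0: "raising n u = 0"
  shows "lowering n u = 0"
proof -
  have "bihomogeneous n d (-1) (lowering n u)" using bihomogeneous_lowering[OF u] by simp
  moreover have "raising n (lowering n u) = 0"
    using u 0 by (simp add: raising_lowering bihomogeneous_def lowering)
  ultimately show ?thesis using negative_weight_eq_0 lowering(4) by force
qed

text \<open>\<open>raising\<close> shifts the bidegree by (0, 1), so the images of different
  components have disjoint supports and cannot cancel.\<close>

lemma kernel_bihomogeneous_sum: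
  assumes h: "h \<in> R n" "raising n h = 0"
  obtains T :: "(int \<times> int) set" and f where "finite T" "h = (\<Sum>t\<in>T. f t)"
    "\<And>t. t \<in> T \<Longrightarrow> raising n (f t) = 0 \<and> (\<exists>d s. bihomogeneous n d s (f t))"
proof -
  define \<gamma> where "\<gamma> m = (grade (\<lambda>v. 1) n m, grade wt_var n m)" for m
  define f where "f t = (\<Sum>m | m \<in> Poly_Mapping.keys h \<and> \<gamma> m = t.
    Poly_Mapping.single m (Poly_Mapping.lookup h m))" for t
  let ?T = "\<gamma> ` Poly_Mapping.keys h"
  have h_eq: "h = (\<Sum>t\<in>?T. f t)"
    unfolding f_def by (subst sum.image_gen [symmetric]) (simp_all flip: poly_mapping_sum_single)
  have keys: "m \<in> Poly_Mapping.keys h \<and> \<gamma> m = t" if "m \<in> Poly_Mapping.keys (f t)" for m t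
    using subsetD[OF Poly_Mapping.keys_sum that[unfolded f_def]] by (auto split: if_splits)
  have hom: "bihomogeneous n (fst t) (snd t) (f t)" for t
    using keys[of _ t] h(1) by (fastforce simp: bihomogeneous_iff \<gamma>_def R_eq poly_ring_def)
  have keys': "\<gamma> m = (fst t, snd t + 1)" if "m \<in> Poly_Mapping.keys (raising n (f t))" for m t
    using that bihomogeneous_raising[OF hom[of t]] by (simp add: bihomogeneous_iff \<gamma>_def)
  have "raising n (f t) = 0" if t: "t \<in> ?T" for t
  proof (rule ccontr)
    assume "raising n (f t) \<noteq> 0"
    then obtain m where m: "m \<in> Poly_Mapping.keys (raising n (f t))"
      by (metis all_not_in_conv keys_eq_empty)
    have "0 = Poly_Mapping.lookup (raising n h) m" using h by simp
    also have "\<dots> = (\<Sum>t'\<in>?T. Poly_Mapping.lookup (raising n (f t')) m)"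
      by (subst h_eq) (simp add: raising lookup_sum)
    also have "\<dots> = (\<Sum>t'\<in>{t}. Poly_Mapping.lookup (raising n (f t')) m)"
    proof (rule sum.mono_neutral_right)
      show "\<forall>t'\<in>?T - {t}. Poly_Mapping.lookup (raising n (f t')) m = 0"
        using keys'[OF m] keys'[of m] by (force simp: in_keys_iff prod_eq_iff)
    qed (use t in auto)
    finally show False using m by (simp add: in_keys_iff)
  qed
  with hom h_eq show ?thesis by (intro that[of ?T f]) auto
qed

lemma hull_subalgebraI:
  assumes "p \<in> is_subalgebra hull S" "is_subalgebra B" "S \<subseteq> B"
  shows "p \<in> B"
  using hull_minimal[of S B is_subalgebra] assms by blast

text \<open>By the Leibniz rule, the elements of the hull that \<open>D\<close> maps back into it
  form a subalgebra.\<close>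

lemma derivation_preserves_hull:
  assumes D: "derivation D" and S: "\<And>g. g \<in> S \<Longrightarrow> D g \<in> is_subalgebra hull S"
    and p: "p \<in> is_subalgebra hull S"
  shows "D p \<in> is_subalgebra hull S"
proof -
  let ?A = "is_subalgebra hull S"
  note A = is_subalgebraD[OF is_subalgebra_hull[of S]]
  have "is_subalgebra {p \<in> ?A. D p \<in> ?A}"
    by (rule is_subalgebraI) (auto simp: derivationD[OF D] intro!: A)
  moreover have "S \<subseteq> {p \<in> ?A. D p \<in> ?A}" using S hull_subset[of S is_subalgebra] by auto
  ultimately show ?thesis using hull_subalgebraI[OF p] by blast
qed

section \<open>The generated algebra is closed under transvectants\<close>

definition gens :: "nat \<Rightarrow> (xyz, 'k::comm_ring_1) mpoly set" where
  "gens n = {f1 i | i. 1 \<le> i \<and> i \<le> n}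
     \<union> {f2 i j | i j. 1 \<le> i \<and> i < j \<and> j \<le> n}
     \<union> {g2 i j | i j. 1 \<le> i \<and> i \<le> j \<and> j \<le> n}
     \<union> {g3 i j k | i j k. 1 \<le> i \<and> i < j \<and> j < k \<and> k \<le> n}"

abbreviation gen_alg :: "nat \<Rightarrow> (xyz, 'k::comm_ring_1) mpoly set" where
  "gen_alg n \<equiv> is_subalgebra hull gens n"

lemmas gen_alg_closed = is_subalgebraD[OF is_subalgebra_hull[where S = "gens n" for n]]

text \<open>Written in the shape of the pairing of the triple of variables of index \<open>i\<close>
  with the triple of \<open>f2 j k\<close>; this is how \<open>triples_pairing\<close> meets the
  determinant.\<close>

lemma g3_eq:
  "g3 i j k = xvar i * (yvar j * zvar k - yvar k * zvar j)
     - yvar i * (xvar j * zvar k - xvar k * zvar j) + zvar i * f2 j k"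
  by (simp add: g3_def f2_def det_3 algebra_simps)

text \<open>Later identities produce indices in any order. Transposing indices changes the sign of
  \<open>f2\<close> and \<open>g3\<close> and fixes \<open>g2\<close>; with coinciding indices
  \<open>f2\<close> and \<open>g3\<close> vanish.\<close>

lemma gen_alg_gens:
  shows "i \<in> {1..n} \<Longrightarrow> (xvar i :: (xyz, 'k::comm_ring_1) mpoly) \<in> gen_alg n"
    and "i \<in> {1..n} \<Longrightarrow> j \<in> {1..n} \<Longrightarrow> (f2 i j :: (xyz, 'k) mpoly) \<in> gen_alg n"
    and "i \<in> {1..n} \<Longrightarrow> j \<in> {1..n} \<Longrightarrow> (g2 i j :: (xyz, 'k) mpoly) \<in> gen_alg n"
    and "i \<in> {1..n} \<Longrightarrow> j \<in> {1..n} \<Longrightarrow> k \<in> {1..n} \<Longrightarrow>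
      (g3 i j k :: (xyz, 'k) mpoly) \<in> gen_alg n"
proof -
  have gens: "p \<in> gen_alg n" if "p \<in> gens n" for p :: "(xyz, 'k) mpoly"
    using that hull_subset[of "gens n" is_subalgebra] by auto
  show "(xvar i :: (xyz, 'k) mpoly) \<in> gen_alg n" if "i \<in> {1..n}"
    using that by (intro gens) (auto simp: gens_def f1_def)
  show "(f2 i j :: (xyz, 'k) mpoly) \<in> gen_alg n" if ij: "i \<in> {1..n}" "j \<in> {1..n}"
  proof (cases i j rule: linorder_cases)
    case less
    then show ?thesis using ij by (intro gens) (auto simp: gens_def)
  next
    case greater
    then have "(f2 j i :: (xyz, 'k) mpoly) \<in> gen_alg n"
      using ij by (intro gens) (auto simp: gens_def)
    from gen_alg_closed(6)[OF this] show ?thesis by (simp add: f2_def)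
  qed (simp add: f2_def gen_alg_closed(2))
  show "(g2 i j :: (xyz, 'k) mpoly) \<in> gen_alg n" if ij: "i \<in> {1..n}" "j \<in> {1..n}"
  proof (cases "i \<le> j")
    case True
    then show ?thesis using ij by (intro gens) (auto simp: gens_def)
  next
    case False
    then have "j \<le> i" by simp
    then have "(g2 j i :: (xyz, 'k) mpoly) \<in> gen_alg n"
      using ij by (intro gens) (auto simp: gens_def)
    moreover have "(g2 i j :: (xyz, 'k) mpoly) = g2 j i" by (simp add: g2_def algebra_simps)
    ultimately show ?thesis by metis
  qed
  have swap: "(g3 b a c :: (xyz, 'k) mpoly) = - g3 a b c" "(g3 a c b :: (xyz, 'k) mpoly) = - g3 a b c"
    for a b c by (simp_all add: g3_eq f2_def algebra_simps)
  have le: "(g3 a b c :: (xyz, 'k) mpoly) \<in> gen_alg n"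
    if "a \<le> b" "b \<le> c" "a \<in> {1..n}" "c \<in> {1..n}" for a b c
  proof (cases "a < b \<and> b < c")
    case True
    then show ?thesis using that by (intro gens) (auto simp: gens_def)
  next
    case False
    then have "(g3 a b c :: (xyz, 'k) mpoly) = 0"
      using that by (auto simp: le_less g3_eq f2_def algebra_simps)
    then show ?thesis by (simp add: gen_alg_closed(2))
  qed
  have swapI: "(g3 b a c :: (xyz, 'k) mpoly) \<in> gen_alg n" "(g3 a c b :: (xyz, 'k) mpoly) \<in> gen_alg n"
    if "(g3 a b c :: (xyz, 'k) mpoly) \<in> gen_alg n" for a b c
    using gen_alg_closed(6)[OF that]
    by (simp_all only: swap[where a = a and b = b and c = c])
  show "(g3 i j k :: (xyz, 'k) mpoly) \<in> gen_alg n" if ijk: "i \<in> {1..n}" "j \<in> {1..n}" "k \<in> {1..n}"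
  proof -
    consider "i \<le> j" "j \<le> k" | "i \<le> k" "k \<le> j" | "j \<le> i" "i \<le> k" | "j \<le> k" "k \<le> i"
      | "k \<le> i" "i \<le> j" | "k \<le> j" "j \<le> i" by linarith
    then show ?thesis
    proof cases
      case 1
      then show ?thesis by (rule le) (use ijk in auto)
    next
      case 2
      show ?thesis by (rule swapI(2)[OF le]) (use 2 ijk in auto)
    next
      case 3
      show ?thesis by (rule swapI(1)[OF le]) (use 3 ijk in auto)
    next
      case 4
      show ?thesis by (rule swapI(1)[OF swapI(2)[OF le]]) (use 4 ijk in auto)
    next
      case 5
      show ?thesis by (rule swapI(2)[OF swapI(1)[OF le]]) (use 5 ijk in auto)
    next
      case 6
      show ?thesis by (rule swapI(1)[OF swapI(2)[OF swapI(1)[OF le]]]) (use 6 ijk in auto)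
    qed
  qed
qed

text \<open>The \<open>(u, \<nabla> u, \<nabla>\<^sup>2 u)\<close> for the generators \<open>u\<close> of weight 1. Each spans a copy of the
  three-dimensional representation, so that the invariant pairing behind \<open>g2\<close> makes sense on them.\<close>

definition triples :: "nat \<Rightarrow> ((xyz, 'k::comm_ring_1) mpoly \<times> (xyz, 'k) mpoly \<times> (xyz, 'k) mpoly) set" where
  "triples n = (\<lambda>j. (xvar j, yvar j, zvar j)) ` {1..n} \<union>
     (\<lambda>(j, k). (f2 j k, xvar j * zvar k - xvar k * zvar j, yvar j * zvar k - yvar k * zvar j))
       ` ({1..n} \<times> {1..n})"

lemma triples_cases:
  assumes "(u, u', u'') \<in> triples n"
  obtains j where "j \<in> {1..n}" "u = xvar j" "u' = yvar j" "u'' = zvar j"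
    | j k where "j \<in> {1..n}" "k \<in> {1..n}" "u = f2 j k" "u' = xvar j * zvar k - xvar k * zvar j"
      "u'' = yvar j * zvar k - yvar k * zvar j"
  using assms by (auto simp: triples_def)

text \<open>The generators \<open>f1\<close>, \<open>f2\<close> are highest weight vectors of
  three-dimensional representations; \<open>g2\<close>, \<open>g3\<close> are invariants, on which
  both transvectants and \<open>symbol2\<close> vanish.\<close>

lemma gens_cases:
  assumes "u \<in> gens n"
  obtains u' u'' where "(u, u', u'') \<in> triples n"
    | "weight n u = 0" "lowering n u = 0"
proof -
  consider (f1) i where "1 \<le> i" "i \<le> n" "u = f1 i" | (f2) i j where "1 \<le> i" "i < j" "j \<le> n" "u = f2 i j"
    | (g2) i j where "1 \<le> i" "i \<le> j" "j \<le> n" "u = g2 i j"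
    | (g3) i j k where "1 \<le> i" "i < j" "j < k" "k \<le> n" "u = g3 i j k"
    using assms unfolding gens_def by blast
  then show ?thesis
  proof cases
    case f1
    then have "(u, yvar i, zvar i) \<in> triples n" by (auto simp: triples_def f1_def)
    then show ?thesis by (rule that(1))
  next
    case f2
    then have "(u, xvar i * zvar j - xvar j * zvar i, yvar i * zvar j - yvar j * zvar i) \<in> triples n"
      by (auto simp: triples_def)
    then show ?thesis by (rule that(1))
  next
    case g2
    have "weight n (g2 i j) = 0" "lowering n (g2 i j) = 0"
      using g2(1-3) by (simp_all add: g2_def grading lowering mconst_minus algebra_simps)
    then show ?thesis using g2 that(2) by blast
  next
    case g3
    have "weight n (g3 i j k) = 0" "lowering n (g3 i j k) = 0"
      using g3(1-4) by (simp_all add: g3_eq f2_def grading lowering mconst_minus algebra_simps)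
    then show ?thesis using g3 that(2) by blast
  qed
qed

lemma triples_ops:
  assumes "(u, u', u'') \<in> triples n"
  shows "weight n u = u" "lowering n u = u'" "lowering n u' = u''" "u \<in> gen_alg n"
proof -
  note S = f2_def grading lowering mconst_minus
  from assms have "weight n u = u \<and> lowering n u = u' \<and> lowering n u' = u'' \<and> u \<in> gen_alg n"
  proof (cases rule: triples_cases)
    case (1 j)
    then show ?thesis by (simp add: gen_alg_gens)
  next
    case (2 j k)
    then have "f2 j k \<in> gen_alg n" by (simp add: gen_alg_gens)
    moreover have "weight n (f2 j k) = f2 j k"
      "lowering n (f2 j k) = xvar j * zvar k - xvar k * zvar j"
      "lowering n (xvar j * zvar k - xvar k * zvar j) = yvar j * zvar k - yvar k * zvar j"
      using 2(1,2) by (simp_all add: S algebra_simps)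
    ultimately show ?thesis by (simp only: 2)
  qed
  then show "weight n u = u" "lowering n u = u'" "lowering n u' = u''" "u \<in> gen_alg n" by auto
qed

text \<open>Two triples of variables pair to \<open>g2\<close>, a triple of variables and an
  \<open>f2\<close> triple to \<open>g3\<close>. The triple of \<open>f2 j k\<close> plays the role
  of a cross product, and two of these pair by the Binet-Cauchy identity \<open>ff\<close>.\<close>

lemma triples_pairing:
  assumes "(u, u', u'') \<in> triples n" "(v, v', v'') \<in> triples n"
  shows "u * v'' - u' * v' + u'' * v \<in> gen_alg n"
proof -
  have xx: "xvar j * zvar k - yvar j * yvar k + zvar j * xvar k = g2 j k" for j k
    by (simp add: g2_def)
  have xf: "xvar i * (yvar j * zvar k - yvar k * zvar j) - yvar i * (xvar j * zvar k - xvar k * zvar j)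
      + zvar i * f2 j k = g3 i j k" for i j k
    by (simp add: g3_eq)
  have fx: "f2 j k * zvar i - (xvar j * zvar k - xvar k * zvar j) * yvar i
      + (yvar j * zvar k - yvar k * zvar j) * xvar i = g3 i j k" for i j k
    by (simp add: g3_eq algebra_simps)
  have ff: "f2 j k * (yvar l * zvar m - yvar m * zvar l)
      - (xvar j * zvar k - xvar k * zvar j) * (xvar l * zvar m - xvar m * zvar l)
      + (yvar j * zvar k - yvar k * zvar j) * f2 l m = g2 j l * g2 k m - g2 j m * g2 k l" for j k l m
    by (simp add: g2_def f2_def algebra_simps)
  show ?thesis
    using assms(1)
  proof (cases rule: triples_cases)
    case (1 j)
    from assms(2) 1 show ?thesis
      by (cases rule: triples_cases) (simp_all only: xx xf gen_alg_gens)
  next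
    case (2 j k)
    from assms(2) 2 show ?thesis
      by (cases rule: triples_cases) (simp_all only: fx ff gen_alg_gens gen_alg_closed)
  qed
qed

text \<open>Maps a constant of weight \<open>w\<close> to a constant of weight \<open>w\<close>:
  \<open>raising\<close> annihilates the value because of \<open>raising_lowering\<close>.\<close>

definition transvectant1 :: "nat \<Rightarrow> nat \<Rightarrow> (xyz, 'k::comm_ring_1) mpoly \<Rightarrow> (xyz, 'k) mpoly" where
  "transvectant1 n i p = yvar i * weight n p - xvar i * lowering n p"

text \<open>On a constant \<open>p\<close> of weight \<open>w\<close> this is \<open>w (2w - 1) z_i
  p - (2w - 1) y_i \<nabla> p + x_i \<nabla> (\<nabla> p)\<close>, a constant of weight
  \<open>w - 1\<close>. Replacing \<open>w\<close> by the operator \<open>weight\<close> makes it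
  linear on all polynomials.\<close>

definition transvectant2 :: "nat \<Rightarrow> nat \<Rightarrow> (xyz, 'k::comm_ring_1) mpoly \<Rightarrow> (xyz, 'k) mpoly" where
  "transvectant2 n i p = zvar i * (2 * weight n (weight n p) - weight n p)
     - yvar i * (2 * lowering n (weight n p) - lowering n p) + xvar i * lowering n (lowering n p)"

text \<open>Half of the defect of the Leibniz rule for \<open>transvectant2\<close>.\<close>

definition symbol2 :: "nat \<Rightarrow> nat \<Rightarrow> (xyz, 'k::comm_ring_1) mpoly \<Rightarrow> (xyz, 'k) mpoly \<Rightarrow> (xyz, 'k) mpoly" where
  "symbol2 n i p q = 2 * zvar i * weight n p * weight n q
     - yvar i * (lowering n p * weight n q + weight n p * lowering n q)
     + xvar i * lowering n p * lowering n q"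

text \<open>Being a derivation, it is determined by the generators: it kills \<open>g2\<close> and
  \<open>g3\<close>, maps \<open>xvar j\<close> to \<open>f2 j i\<close>, and maps
  \<open>f2 j k\<close> to \<open>xvar k * g2 i j - xvar j * g2 i k\<close>.\<close>

lemma transvectant1_in_gen_alg:
  assumes i: "i \<in> {1..n}" and p: "p \<in> gen_alg n"
  shows "transvectant1 n i p \<in> gen_alg n"
proof (rule derivation_preserves_hull[OF _ _ p])
  show "derivation (transvectant1 n i)"
    by (simp add: derivation_def transvectant1_def grading lowering algebra_simps)
  fix g assume "g \<in> gens n"
  then show "transvectant1 n i g \<in> gen_alg n"
  proof (cases rule: gens_cases)
    case (1 u' u'')
    have eq: "transvectant1 n i g = yvar i * g - xvar i * u'"
      by (simp add: transvectant1_def triples_ops[OF 1])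
    from 1 show ?thesis
    proof (cases rule: triples_cases)
      case (1 j)
      then have "yvar i * g - xvar i * u' = f2 j i" by (simp add: f2_def algebra_simps)
      then show ?thesis using gen_alg_gens(2)[OF 1(1) i] by (simp only: eq)
    next
      case (2 j k)
      have "yvar i * g - xvar i * u' = xvar k * g2 i j - xvar j * g2 i k"
        unfolding 2(3,4) f2_def g2_def by (simp add: algebra_simps)
      then show ?thesis using i 2(1,2) by (simp only: eq gen_alg_closed gen_alg_gens)
    qed
  qed (simp add: transvectant1_def gen_alg_closed)
qed

text \<open>Symmetric and a derivation in each argument, so pairs of generators suffice, and there
  it vanishes unless both have weight 1.\<close>

lemma symbol2_in_gen_alg:
  assumes i: "i \<in> {1..n}" and p: "p \<in> gen_alg n" and q: "q \<in> gen_alg n"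
  shows "symbol2 n i p q \<in> gen_alg n"
proof -
  have D: "derivation (symbol2 n i p)" for p
    by (simp add: derivation_def symbol2_def grading lowering algebra_simps)
  have sym: "symbol2 n i p q = symbol2 n i q p" for p q
    by (simp add: symbol2_def algebra_simps)
  have gg: "symbol2 n i u v \<in> gen_alg n" if u: "u \<in> gens n" and v: "v \<in> gens n" for u v
    using u
  proof (cases rule: gens_cases)
    case (1 u' u'')
    note u = 1
    from v show ?thesis
    proof (cases rule: gens_cases)
      case (1 v' v'')
      note v = 1
      have x: "(xvar i, yvar i, zvar i) \<in> triples n" using i by (auto simp: triples_def)
      \<comment> \<open>In weight 1 the value is a combination of the three pairings among the
        triples of \<open>u\<close>, of \<open>v\<close> and of the variables of index
        \<open>i\<close>.\<close>
      have "symbol2 n i u v = v * (xvar i * u'' - yvar i * u' + zvar i * u)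
          + u * (xvar i * v'' - yvar i * v' + zvar i * v) - xvar i * (u * v'' - u' * v' + u'' * v)"
        unfolding symbol2_def triples_ops[OF u] triples_ops[OF v] by (simp add: algebra_simps)
      then show ?thesis
        by (simp only: gen_alg_closed(7)[OF gen_alg_closed(4)[OF
          gen_alg_closed(5)[OF triples_ops(4)[OF v] triples_pairing[OF x u]]
          gen_alg_closed(5)[OF triples_ops(4)[OF u] triples_pairing[OF x v]]]
          gen_alg_closed(5)[OF triples_ops(4)[OF x] triples_pairing[OF u v]]])
    qed (simp add: symbol2_def gen_alg_closed)
  qed (simp add: symbol2_def gen_alg_closed)
  have "symbol2 n i u q \<in> gen_alg n" if "u \<in> gens n" for u
    by (rule derivation_preserves_hull[OF D gg[OF that] q])
  then show ?thesis
    by (subst sym) (rule derivation_preserves_hull[OF D _ p], subst sym)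
qed

text \<open>The correction \<open>symbol2\<close> in the product rule already lies in the algebra,
  so \<open>?B\<close> is closed under products. On a generator of weight 1 the value is the pairing
  with the triple of variables.\<close>

lemma transvectant2_in_gen_alg:
  assumes i: "i \<in> {1..n}" and p: "p \<in> gen_alg n"
  shows "transvectant2 n i p \<in> gen_alg n"
proof -
  let ?B = "{p \<in> gen_alg n. transvectant2 n i p \<in> gen_alg n}"
  have mult: "transvectant2 n i (p * q) = transvectant2 n i p * q + p * transvectant2 n i q
      + (symbol2 n i p q + symbol2 n i p q)" for p q
    by (simp add: transvectant2_def symbol2_def grading lowering algebra_simps)
  have add: "transvectant2 n i (p + q) = transvectant2 n i p + transvectant2 n i q" for p q
    by (simp add: transvectant2_def grading lowering algebra_simps)
  have const: "transvectant2 n i (mconst c) = 0" for c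
    by (simp add: transvectant2_def grading lowering)
  have "is_subalgebra ?B"
    by (rule is_subalgebraI)
      (auto simp only: mem_Collect_eq mult add const intro!: gen_alg_closed symbol2_in_gen_alg[OF i])
  moreover have "gens n \<subseteq> ?B"
  proof
    fix g assume g: "g \<in> gens n"
    then have "g \<in> gen_alg n" using hull_subset[of "gens n" is_subalgebra] by auto
    moreover from g have "transvectant2 n i g \<in> gen_alg n"
    proof (cases rule: gens_cases)
      case (1 u' u'')
      have x: "(xvar i, yvar i, zvar i) \<in> triples n" using i by (auto simp: triples_def)
      have "transvectant2 n i g = xvar i * u'' - yvar i * u' + zvar i * g"
        unfolding transvectant2_def triples_ops[OF 1] by (simp add: algebra_simps)
      then show ?thesis using triples_pairing[OF x 1] by simp
    qed (simp add: transvectant2_def grading lowering gen_alg_closed)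
    ultimately show "g \<in> ?B" by simp
  qed
  ultimately show ?thesis using hull_subalgebraI[OF p] by blast
qed

section \<open>Generation of the algebra of constants\<close>

lemma gen_alg_subset_constants: "gen_alg n \<subseteq> constants n"
proof (rule hull_minimal)
  show "is_subalgebra (constants n)"
    unfolding constants_def Delta_eq_raising
    by (rule is_subalgebraI) (auto simp: raising intro: R_closed)
  have "p \<in> R n \<and> raising n p = 0" if p: "p \<in> gens n" for p
  proof -
    consider (f1) i where "1 \<le> i" "i \<le> n" "p = f1 i" | (f2) i j where "1 \<le> i" "i < j" "j \<le> n" "p = f2 i j"
      | (g2) i j where "1 \<le> i" "i \<le> j" "j \<le> n" "p = g2 i j"
      | (g3) i j k where "1 \<le> i" "i < j" "j < k" "k \<le> n" "p = g3 i j k"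
      using p unfolding gens_def by blast
    then show ?thesis
    proof cases
      case f1
      then show ?thesis by (simp add: f1_def mvar_in_R)
    next
      case f2
      then have "f2 i j \<in> R n \<and> raising n (f2 i j) = 0"
        by (simp add: f2_def R_closed mvar_in_R raising)
      then show ?thesis by (simp only: f2)
    next
      case g2
      then have "g2 i j \<in> R n \<and> raising n (g2 i j) = 0"
        by (simp add: g2_def R_closed mvar_in_R raising algebra_simps)
      then show ?thesis by (simp only: g2)
    next
      case g3
      then have "g3 i j k \<in> R n" "raising n (g3 i j k) = 0"
        by (simp_all add: g3_eq f2_def R_closed mvar_in_R raising)
      then show ?thesis by (simp only: g3)
    qed
  qed
  then show "gens n \<subseteq> constants n"
    unfolding constants_def Delta_eq_raising by auto
qed

lemma of_int_double_minus_1_neq_0: "2 * of_int w - 1 \<noteq> (0 :: 'k::field_char_0)" for w :: int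
proof -
  have "2 * w - 1 \<noteq> 0" by presburger
  then have "of_int (2 * w - 1) \<noteq> (0 :: 'k)" by (simp only: of_int_eq_0_iff not_False_eq_True)
  then show ?thesis by simp
qed

text \<open>The Clebsch--Gordan decomposition of \<open>x\<^sub>i a + y\<^sub>i b + z\<^sub>i c\<close> into transvectants
  of highest weight vectors.\<close>

lemma clebsch_gordan_in_gen_alg:
  fixes a b c :: "(xyz, 'k::field_char_0) mpoly"
  assumes i: "i \<in> {1..n}" and s: "0 \<le> s"
    and a: "bihomogeneous n e (s - 1) a" "raising n a = - b"
    and b: "bihomogeneous n e s b" "raising n b = - c"
    and c: "bihomogeneous n e (s + 1) c" "raising n c = 0"
    and IH: "\<And>t u. bihomogeneous n e t (u :: (xyz, 'k) mpoly) \<Longrightarrow> raising n u = 0 \<Longrightarrow> u \<in> gen_alg n"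
  shows "xvar i * a + yvar i * b + zvar i * c \<in> gen_alg n"
proof -
  \<comment> \<open>\<open>W\<close> is the weight of \<open>c\<close>, positive since
    \<open>0 \<le> s\<close>. \<open>K = W + (W - 1)\<close> is the factor by which
    \<open>raising\<close> takes \<open>?l (?l c)\<close> back to \<open>?l c\<close>. The scalar
    \<kappa> normalises the coefficient of \<open>zvar i\<close> in
    \<open>transvectant2 n i c\<close> to \<open>c\<close>.\<close>
  define W :: 'k where "W = of_int (s + 1)"
  define K :: 'k where "K = 2 * W - 1"
  define \<kappa> :: "(xyz, 'k) mpoly" where "\<kappa> = mconst (1 / (W * K))"
  define \<omega> :: "(xyz, 'k) mpoly" where "\<omega> = mconst (1 / W)"
  let ?l = "lowering n"
  have W0: "W \<noteq> 0" using s by (simp only: W_def of_int_eq_0_iff)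
  have K0: "K \<noteq> 0" unfolding K_def W_def by (rule of_int_double_minus_1_neq_0)
  have cR: "c \<in> R n" "?l c \<in> R n" using c op_in_R by (auto simp: bihomogeneous_def)
  have wc: "weight n c = mconst W * c" "weight n (?l c) = mconst (W - 1) * ?l c"
    using c bihomogeneous_lowering[OF c(1)] by (simp_all add: bihomogeneous_def W_def)
  have rlc: "raising n (?l c) = mconst W * c"
    using raising_lowering[OF cR(1)] c wc by (simp add: lowering)
  have rllc: "raising n (?l (?l c)) = mconst K * ?l c"
    using raising_lowering[OF cR(2)] wc
    by (simp add: rlc lowering K_def flip: distrib_right mconst_add)
  \<comment> \<open>The coefficients of \<open>yvar i\<close> and \<open>xvar i\<close> that remain
    after subtracting \<open>\<kappa> * transvectant2 n i c\<close>.\<close>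
  define b' where "b' = b + \<omega> * ?l c"
  define a1 where "a1 = a - \<kappa> * ?l (?l c)"
  have \<omega>W: "\<omega> * mconst W = 1" and \<kappa>K: "\<kappa> * mconst K = \<omega>"
    using W0 K0 by (simp_all add: \<omega>_def \<kappa>_def flip: mconst_mult)
  have rb': "raising n b' = 0"
    using \<omega>W by (simp add: b'_def b raising \<omega>_def rlc mult.assoc [symmetric])
  have ra1: "raising n a1 = - b'"
    using \<kappa>K by (simp add: a1_def a raising \<kappa>_def rllc mult.assoc [symmetric] b'_def)
  have hlc: "bihomogeneous n e s (?l c)" using bihomogeneous_lowering[OF c(1)] by simp
  have hb': "bihomogeneous n e s b'"
    unfolding b'_def \<omega>_def by (intro bihomogeneous_add b bihomogeneous_smult hlc)
  have ha1: "bihomogeneous n e (s - 1) a1"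
  proof -
    have "a1 = a + mconst (- 1 / (W * K)) * ?l (?l c)" by (simp add: a1_def \<kappa>_def mconst_minus)
    then show ?thesis
      by (auto intro!: bihomogeneous_add a bihomogeneous_smult bihomogeneous_lowering hlc)
  qed
  have "\<exists>\<sigma> a'. raising n a' = 0 \<and> bihomogeneous n e (s - 1) a' \<and>
    xvar i * a1 + yvar i * b' = xvar i * a' + mconst \<sigma> * transvectant1 n i b'"
  proof (cases "s = 0")
    case True
    \<comment> \<open>In weight 0 no division by \<open>s\<close> is possible, but the remainder
      vanishes: \<open>lowering\<close> kills \<open>b'\<close>, which is
      \<open>raising n a1\<close> up to sign, so \<open>a1\<close> of weight -1 is 0, and then so is
      \<open>b'\<close>.\<close>
    have "?l b' = 0" using zero_weight_lowering_eq_0[OF _ rb'] hb' True by simp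
    then have "a1 = 0" using negative_weight_eq_0[OF ha1] True by (simp add: ra1 lowering)
    moreover from this have "b' = 0" using ra1 by (simp add: raising)
    ultimately show ?thesis using ha1
      by (intro exI[of _ 0]) (simp add: raising)
  next
    case False
    \<comment> \<open>Division by the weight of \<open>b'\<close> makes \<open>b'\<close> the
      coefficient of \<open>yvar i\<close> in the first transvectant; \<open>a'\<close> collects
      what is left at \<open>xvar i\<close>.\<close>
    define \<sigma> :: 'k where "\<sigma> = 1 / of_int s"
    define a' where "a' = a1 + mconst \<sigma> * ?l b'"
    have \<sigma>: "mconst \<sigma> * mconst (of_int s) = (1 :: (xyz, 'k) mpoly)"
      using False by (simp add: \<sigma>_def flip: mconst_mult)
    have wb': "weight n b' = mconst (of_int s) * b'" "b' \<in> R n"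
      using hb' by (simp_all add: bihomogeneous_def)
    have "raising n a' = 0"
      using \<sigma> raising_lowering[OF wb'(2)]
      by (simp add: a'_def raising ra1 rb' wb' lowering mult.assoc [symmetric])
    moreover have "bihomogeneous n e (s - 1) a'"
      unfolding a'_def by (intro bihomogeneous_add ha1 bihomogeneous_smult bihomogeneous_lowering hb')
    moreover have "xvar i * a1 + yvar i * b' = xvar i * a' + mconst \<sigma> * transvectant1 n i b'"
    proof -
      have "mconst \<sigma> * transvectant1 n i b'
          = yvar i * (mconst \<sigma> * mconst (of_int s) * b') - xvar i * (mconst \<sigma> * ?l b')"
        by (simp add: transvectant1_def wb' algebra_simps)
      then show ?thesis by (simp add: \<sigma> a'_def algebra_simps)
    qed
    ultimately show ?thesis by blast
  qed
  then obtain \<sigma> a' where a': "raising n a' = 0" "bihomogeneous n e (s - 1) a'"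
    and eq1: "xvar i * a1 + yvar i * b' = xvar i * a' + mconst \<sigma> * transvectant1 n i b'" by blast
  have mK: "mconst K = 2 * mconst W - (1 :: (xyz, 'k) mpoly)"
    unfolding K_def mult_2 mconst_diff mconst_add mconst_1 ..
  have T2: "transvectant2 n i c = zvar i * (mconst (W * K) * c) - yvar i * (mconst K * ?l c)
      + xvar i * ?l (?l c)"
    unfolding transvectant2_def wc grading lowering mconst_mult mK by (simp add: algebra_simps)
  have "\<kappa> * transvectant2 n i c = zvar i * ((\<kappa> * mconst K * mconst W) * c)
      - yvar i * ((\<kappa> * mconst K) * ?l c) + xvar i * (\<kappa> * ?l (?l c))"
    unfolding T2 mconst_mult by (simp add: algebra_simps)
  then have eq2: "\<kappa> * transvectant2 n i c
      = zvar i * c - yvar i * (\<omega> * ?l c) + xvar i * (\<kappa> * ?l (?l c))"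
    by (simp add: \<kappa>K \<omega>W)
  have "xvar i * a + yvar i * b + zvar i * c
      = (xvar i * a1 + yvar i * b') + \<kappa> * transvectant2 n i c"
    unfolding eq2 a1_def b'_def by (simp add: algebra_simps)
  also have "\<dots> = xvar i * a' + mconst \<sigma> * transvectant1 n i b' + \<kappa> * transvectant2 n i c"
    by (simp only: eq1)
  also have "\<dots> \<in> gen_alg n"
    unfolding \<kappa>_def
    by (intro gen_alg_closed(1,4,5) gen_alg_gens(1) transvectant1_in_gen_alg transvectant2_in_gen_alg i
        IH[OF a'(2,1)] IH[OF hb' rb'] IH[OF c])
  finally show ?thesis .
qed

lemma bihomogeneous_kernel_in_gen_alg:
  fixes h :: "(xyz, 'k::field_char_0) mpoly"
  assumes "bihomogeneous n (int d) s h" "raising n h = 0"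
  shows "h \<in> gen_alg n"
  using assms
proof (induction d arbitrary: s h rule: less_induct)
  case (less d)
  show ?case
  proof (cases "d = 0")
    case True
    \<comment> \<open>In degree 0 only the monomial 1 can occur, so \<open>h\<close> is a
      scalar.\<close>
    have "m = 0" if m: "m \<in> Poly_Mapping.keys h" for m
    proof -
      have "Poly_Mapping.keys m \<subseteq> vars n" "grade (\<lambda>v. 1) n m = 0"
        using less.prems(1) m True by (auto simp: bihomogeneous_iff R_eq poly_ring_def)
      then show "m = 0"
        by (auto simp: grade_def sum_nonneg_eq_0_iff poly_mapping_eq_iff fun_eq_iff in_keys_iff)
    qed
    then have "h = mconst (Poly_Mapping.lookup h 0)"
      by (intro poly_mapping_eqI) (auto simp: mconst_def lookup_single when_def in_keys_iff)
    then show ?thesis by (metis gen_alg_closed(1))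
  next
    case False
    have h: "h \<in> R n" "raising n h = 0" "euler n h = mconst (of_nat d) * h"
      using less.prems by (simp_all add: bihomogeneous_def)
    have IH: "u \<in> gen_alg n" if "bihomogeneous n (int d - 1) t u" "raising n u = 0"
      for t and u :: "(xyz, 'k) mpoly"
      using less.IH[of "d - 1" t u] that False by (simp add: of_nat_diff)
    show ?thesis
    proof (cases "h = 0")
      case True
      then show ?thesis by (simp add: gen_alg_closed(2))
    next
      case h0: False
      \<comment> \<open>A nonzero constant cannot have negative weight; this supplies the sign
        condition of the Clebsch-Gordan step.\<close>
      then have "0 \<le> s"
        using negative_weight_eq_0[OF less.prems(1)] h(2) by (force simp: lowering)
      have T: "xvar i * partial_deriv (X i) h + yvar i * partial_deriv (Y i) h
          + zvar i * partial_deriv (Z i) h \<in> gen_alg n" if i: "i \<in> {1..n}" for i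
      proof (rule clebsch_gordan_in_gen_alg[OF i \<open>0 \<le> s\<close> _ _ _ _ _ _ IH])
        note b = bihomogeneous_partial_deriv[OF less.prems(1)]
        show "bihomogeneous n (int d - 1) (s - 1) (partial_deriv (X i) h)"
          "bihomogeneous n (int d - 1) s (partial_deriv (Y i) h)"
          "bihomogeneous n (int d - 1) (s + 1) (partial_deriv (Z i) h)"
          using b[of "X i"] b[of "Y i"] b[of "Z i"] by simp_all
        show "raising n (partial_deriv (X i) h) = - partial_deriv (Y i) h"
          using partial_deriv_X_raising[OF h(1), of i] h(2) by (simp add: pderiv eq_neg_iff_add_eq_0)
        show "raising n (partial_deriv (Y i) h) = - partial_deriv (Z i) h"
          using partial_deriv_Y_raising[OF h(1), of i] h(2) by (simp add: pderiv eq_neg_iff_add_eq_0)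
        show "raising n (partial_deriv (Z i) h) = 0"
          using partial_deriv_Z_raising[OF h(1), of i] h(2) by (simp add: pderiv)
      qed
      have "euler n h = (\<Sum>i=1..n. xvar i * partial_deriv (X i) h + yvar i * partial_deriv (Y i) h
          + zvar i * partial_deriv (Z i) h)"
        by (simp add: grading_def der_def sum_vars)
      also have "\<dots> \<in> gen_alg n" by (intro gen_alg_closed(8) T)
      \<comment> \<open>Euler's formula gives \<open>d\<close> times \<open>h\<close>, and
        \<open>d\<close> is invertible in characteristic 0.\<close>
      finally have "mconst (1 / of_nat d) * (mconst (of_nat d) * h) \<in> gen_alg n"
        unfolding h(3) by (rule gen_alg_closed(5)[OF gen_alg_closed(1)])
      moreover have "mconst (1 / of_nat d) * (mconst (of_nat d) * h) = h"
        using False by (simp add: mult.assoc [symmetric] mconst_mult [symmetric])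
      ultimately show ?thesis by (simp only:)
    qed
  qed
qed

lemma gen_alg_eq_constants: "gen_alg n = (constants n :: (xyz, 'k::field_char_0) mpoly set)"
proof
  show "constants n \<subseteq> (gen_alg n :: (xyz, 'k) mpoly set)"
  proof
    fix h :: "(xyz, 'k) mpoly"
    assume "h \<in> constants n"
    then have "h \<in> R n" "raising n h = 0" by (auto simp: constants_def Delta_eq_raising)
    then obtain T :: "(int \<times> int) set" and f where h: "h = (\<Sum>t\<in>T. f t)"
      and f: "\<And>t. t \<in> T \<Longrightarrow> raising n (f t) = 0 \<and> (\<exists>d s. bihomogeneous n d s (f t))"
      by (rule kernel_bihomogeneous_sum) blast
    have "f t \<in> gen_alg n" if t: "t \<in> T" for t
    proof (cases "f t = 0")
      case False
      obtain d s where b: "bihomogeneous n d s (f t)" using f[OF t] by blast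
      \<comment> \<open>Degrees are integers here; that of a nonzero component is nonnegative, so
        \<open>nat\<close> loses nothing.\<close>
      then have "bihomogeneous n (int (nat d)) s (f t)" using bihomogeneous_bounds(1)[OF b False] by simp
      then show ?thesis using bihomogeneous_kernel_in_gen_alg f[OF t] by blast
    qed (simp add: gen_alg_closed(2))
    then show "h \<in> gen_alg n" unfolding h by (intro gen_alg_closed(8))
  qed
qed (rule gen_alg_subset_constants)

section \<open>Minimality\<close>

text \<open>The polynomials none of whose monomials is a squarefree product of variables from \<open>S\<close>
  of positive \<open>\<theta>\<close>-weight. Any factorization of a monomial of this kind has a factor of
  the same kind, so these polynomials form a subalgebra.\<close>

definition avoiding :: "('v \<Rightarrow> int) \<Rightarrow> 'v set \<Rightarrow> ('v, 'k::comm_ring_1) mpoly set" where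
  "avoiding \<theta> S = {p. \<forall>m\<in>Poly_Mapping.keys p.
    \<not> (0 < (\<Sum>v\<in>S. \<theta> v * int (Poly_Mapping.lookup m v)) \<and>
       (\<forall>v. Poly_Mapping.lookup m v \<le> (if v \<in> S then 1 else 0)))}"

lemma is_subalgebra_avoiding: "is_subalgebra (avoiding \<theta> S :: ('v, 'k::comm_ring_1) mpoly set)"
proof (rule is_subalgebraI)
  show "mconst c \<in> avoiding \<theta> S" for c :: 'k
    by (auto simp: mconst_def avoiding_def split: if_splits)
next
  fix p q :: "('v, 'k) mpoly"
  assume p: "p \<in> avoiding \<theta> S" and q: "q \<in> avoiding \<theta> S"
  then show "p + q \<in> avoiding \<theta> S"
    using Poly_Mapping.keys_add[of p q] unfolding avoiding_def by blast
  let ?\<phi> = "\<lambda>m. \<Sum>v\<in>S. \<theta> v * int (Poly_Mapping.lookup m v)"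
  show "p * q \<in> avoiding \<theta> S"
    unfolding avoiding_def
  proof (intro CollectI ballI notI)
    fix m assume "m \<in> Poly_Mapping.keys (p * q)"
      and *: "0 < ?\<phi> m \<and> (\<forall>v. Poly_Mapping.lookup m v \<le> (if v \<in> S then 1 else 0))"
    then obtain k l where kl: "k \<in> Poly_Mapping.keys p" "l \<in> Poly_Mapping.keys q" "m = k + l"
      using keys_mult[of p q] by blast
    have "Poly_Mapping.lookup k v + Poly_Mapping.lookup l v \<le> (if v \<in> S then 1 else 0)" for v
      using *[THEN conjunct2, rule_format, of v] by (simp add: kl lookup_add)
    then have "Poly_Mapping.lookup k v \<le> (if v \<in> S then 1 else 0)"
      "Poly_Mapping.lookup l v \<le> (if v \<in> S then 1 else 0)" for v
      using add_leD1 add_leD2 by blast+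
    moreover have "0 < ?\<phi> k + ?\<phi> l"
      using * by (simp add: kl(3) lookup_add distrib_left sum.distrib)
    then have "0 < ?\<phi> k \<or> 0 < ?\<phi> l" by linarith
    ultimately show False using p q kl unfolding avoiding_def by blast
  qed
qed

lemmas avoiding_closed = is_subalgebraD[OF is_subalgebra_avoiding]

text \<open>The generators are sums of products of at most three variables. A repeated variable
  destroys squarefreeness, whence the distinctness conditions.\<close>

lemma avoiding_mvar:
  assumes "finite S"
  shows "(mvar u :: ('v, 'k::comm_ring_1) mpoly) \<in> avoiding \<theta> S \<longleftrightarrow> \<not> (0 < \<theta> u \<and> u \<in> S)"
    and "(mvar u * mvar v :: ('v, 'k) mpoly) \<in> avoiding \<theta> S \<longleftrightarrow>
      \<not> (0 < \<theta> u + \<theta> v \<and> u \<in> S \<and> v \<in> S \<and> u \<noteq> v)"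
    and "(mvar u * mvar v * mvar w :: ('v, 'k) mpoly) \<in> avoiding \<theta> S \<longleftrightarrow>
      \<not> (0 < \<theta> u + \<theta> v + \<theta> w \<and> u \<in> S \<and> v \<in> S \<and> w \<in> S \<and> distinct [u, v, w])"
proof -
  let ?s = "\<lambda>u. Poly_Mapping.single u (1::nat)"
  let ?\<phi> = "\<lambda>m. \<Sum>v\<in>S. \<theta> v * int (Poly_Mapping.lookup m v)"
  let ?b = "\<lambda>m. \<forall>v. Poly_Mapping.lookup m v \<le> (if v \<in> S then 1 else 0)"
  have av: "(Poly_Mapping.single m 1 :: ('v, 'k) mpoly) \<in> avoiding \<theta> S \<longleftrightarrow> \<not> (0 < ?\<phi> m \<and> ?b m)" for m
    by (simp add: avoiding_def)
  have \<phi>1: "?\<phi> (?s u) = (if u \<in> S then \<theta> u else 0)" for u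
    using assms by (simp add: lookup_single when_def if_distrib cong: if_cong)
  have \<phi>: "?\<phi> (k + l) = ?\<phi> k + ?\<phi> l" for k l
    by (simp add: lookup_add distrib_left sum.distrib)
  have "?b (?s u) \<longleftrightarrow> u \<in> S"
    by (auto simp: lookup_single when_def split: if_splits)
  then show "(mvar u :: ('v, 'k) mpoly) \<in> avoiding \<theta> S \<longleftrightarrow> \<not> (0 < \<theta> u \<and> u \<in> S)"
    unfolding mvar_def av \<phi>1 by auto
  have "?b (?s u + ?s v) \<longleftrightarrow> u \<in> S \<and> v \<in> S \<and> u \<noteq> v"
    by (auto simp: lookup_single lookup_add when_def split: if_splits)
  then show "(mvar u * mvar v :: ('v, 'k) mpoly) \<in> avoiding \<theta> S \<longleftrightarrow>
      \<not> (0 < \<theta> u + \<theta> v \<and> u \<in> S \<and> v \<in> S \<and> u \<noteq> v)"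
    unfolding mvar_def mult_single mult_1_right av \<phi> \<phi>1 by auto
  have "?b (?s u + ?s v + ?s w) \<longleftrightarrow> u \<in> S \<and> v \<in> S \<and> w \<in> S \<and> distinct [u, v, w]"
    by (auto simp: lookup_single lookup_add when_def split: if_splits)
  then show "(mvar u * mvar v * mvar w :: ('v, 'k) mpoly) \<in> avoiding \<theta> S \<longleftrightarrow>
      \<not> (0 < \<theta> u + \<theta> v + \<theta> w \<and> u \<in> S \<and> v \<in> S \<and> w \<in> S \<and> distinct [u, v, w])"
    unfolding mvar_def mult_single mult_1_right av \<phi> \<phi>1 by auto
qed

lemma g3_expand:
  "g3 i j k = xvar i * yvar j * zvar k - xvar i * yvar k * zvar j - xvar j * yvar i * zvar k
     + xvar k * yvar i * zvar j + xvar j * yvar k * zvar i - xvar k * yvar j * zvar i"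
  by (simp add: g3_eq f2_def algebra_simps)

text \<open>\<open>S\<close> holds the variables of one monomial of \<open>s\<close>, and \<theta>
  is positive on that monomial but not on those of its factors that are monomials of other
  generators. All other monomials of \<open>s\<close> lie in the avoiding algebra, so membership of
  \<open>s\<close> would force membership of the chosen one.\<close>

lemma gens_minus_avoiding:
  fixes s :: "(xyz, 'k::field_char_0) mpoly"
  assumes "s \<in> gens n"
  obtains \<theta> S where "gens n - {s} \<subseteq> avoiding \<theta> S" "s \<notin> avoiding \<theta> S"
proof -
  have gensE: "P" if "t \<in> gens n"
    "\<And>i. t = f1 i \<Longrightarrow> P" "\<And>i j. i < j \<Longrightarrow> t = f2 i j \<Longrightarrow> P"
    "\<And>i j. i \<le> j \<Longrightarrow> t = g2 i j \<Longrightarrow> P" "\<And>i j k. i < j \<Longrightarrow> j < k \<Longrightarrow> t = g3 i j k \<Longrightarrow> P"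
    for P and t :: "(xyz, 'k) mpoly"
    using that unfolding gens_def by blast
  from assms show thesis
  proof (rule gensE)
    fix i assume s: "s = f1 i"
    let ?B = "avoiding (\<lambda>_. 1) {X i} :: (xyz, 'k) mpoly set"
    have "t \<in> ?B" if "t \<in> gens n" "t \<noteq> s" for t
      using that(1)
      by (rule gensE) (use that(2) s in \<open>auto simp: f1_def f2_def g2_def g3_expand avoiding_mvar
          intro!: avoiding_closed(4,7)\<close>)
    moreover have "s \<notin> ?B" by (simp add: s f1_def avoiding_mvar)
    ultimately show thesis by (intro that[of _ "{X i}"]) auto
  next
    fix i j :: nat assume ij: "i < j" and s: "s = f2 i j"
    let ?\<theta> = "\<lambda>v. case v of X _ \<Rightarrow> (0 :: int) | Y _ \<Rightarrow> 1 | Z _ \<Rightarrow> 0"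
    let ?B = "avoiding ?\<theta> {X i, Y j} :: (xyz, 'k) mpoly set"
    have "t \<in> ?B" if "t \<in> gens n" "t \<noteq> s" for t
      using that(1)
      by (rule gensE) (use that(2) s ij in \<open>auto simp: f1_def f2_def g2_def g3_expand avoiding_mvar
          intro!: avoiding_closed(4,7)\<close>)
    moreover have "s \<notin> ?B"
    proof
      assume "s \<in> ?B"
      then have "f2 i j + xvar j * yvar i \<in> ?B"
        using ij by (intro avoiding_closed(4)) (auto simp: s avoiding_mvar)
      then show False by (simp add: f2_def avoiding_mvar)
    qed
    ultimately show thesis by (intro that[of ?\<theta> "{X i, Y j}"]) auto
  next
    fix i j :: nat assume ij: "i \<le> j" and s: "s = g2 i j"
    let ?\<theta> = "\<lambda>v. case v of X _ \<Rightarrow> (0 :: int) | Y _ \<Rightarrow> 0 | Z _ \<Rightarrow> 1"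
    let ?B = "avoiding ?\<theta> {X i, Z j} :: (xyz, 'k) mpoly set"
    have "t \<in> ?B" if "t \<in> gens n" "t \<noteq> s" for t
      using that(1)
      by (rule gensE) (use that(2) s ij in \<open>auto simp: f1_def f2_def g2_def g3_expand avoiding_mvar
          intro!: avoiding_closed(4,7)\<close>)
    moreover have "s \<notin> ?B"
    proof
      assume "s \<in> ?B"
      then have *: "g2 i j + yvar i * yvar j \<in> ?B"
        by (intro avoiding_closed(4)) (auto simp: s avoiding_mvar)
      have "xvar i * zvar j \<in> ?B"
      proof (cases "i = j")
        case True
        \<comment> \<open>On the diagonal the two outer terms of \<open>g2\<close> coincide, so the
          chosen monomial has coefficient 2.\<close>
        have "mconst (1 / 2) * (g2 i j + yvar i * yvar j) \<in> ?B"
          by (rule avoiding_closed(5)[OF avoiding_closed(1) *])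
        also have "mconst (1 / 2) * (g2 i j + yvar i * yvar j)
            = (mconst (1 / 2) + mconst (1 / 2)) * (xvar i * zvar j :: (xyz, 'k) mpoly)"
          by (simp add: True g2_def algebra_simps)
        also have "\<dots> = xvar i * zvar j" by (simp flip: mconst_add)
        finally show ?thesis .
      next
        case False
        have "g2 i j + yvar i * yvar j - zvar i * xvar j \<in> ?B"
          using False by (intro avoiding_closed(7)[OF *]) (auto simp: avoiding_mvar)
        then show ?thesis by (simp add: g2_def)
      qed
      then show False by (simp add: avoiding_mvar)
    qed
    ultimately show thesis by (intro that[of ?\<theta> "{X i, Z j}"]) auto
  next
    fix i j k :: nat assume ijk: "i < j" "j < k" and s: "s = g3 i j k"
    \<comment> \<open>The value -1 gives weight 0 to \<open>x_i y_j\<close> and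
      \<open>x_i z_k\<close>, which occur in \<open>f2 i j\<close> and \<open>g2 i k\<close>, while
      \<open>x_i y_j z_k\<close> keeps weight 1. The factor \<open>y_j z_k\<close> of weight 2 is a
      monomial of no generator.\<close>
    let ?\<theta> = "\<lambda>v. case v of X _ \<Rightarrow> (- 1 :: int) | Y _ \<Rightarrow> 1 | Z _ \<Rightarrow> 1"
    let ?B = "avoiding ?\<theta> {X i, Y j, Z k} :: (xyz, 'k) mpoly set"
    have "t \<in> ?B" if "t \<in> gens n" "t \<noteq> s" for t
      using that(1)
      by (rule gensE) (use that(2) s ijk in \<open>auto simp: f1_def f2_def g2_def g3_expand avoiding_mvar
          intro!: avoiding_closed(4,7)\<close>)
    moreover have "s \<notin> ?B"
    proof
      let ?r = "xvar i * yvar k * zvar j + xvar j * yvar i * zvar k - xvar k * yvar i * zvar j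
        - xvar j * yvar k * zvar i + xvar k * yvar j * zvar i"
      assume "s \<in> ?B"
      moreover have "?r \<in> ?B"
        using ijk by (intro avoiding_closed(4,7)) (auto simp: avoiding_mvar)
      ultimately have "s + ?r \<in> ?B" by (rule avoiding_closed(4))
      also have "s + ?r = xvar i * yvar j * zvar k" by (simp add: s g3_expand)
      finally show False by (simp add: avoiding_mvar)
    qed
    ultimately show thesis by (intro that[of ?\<theta> "{X i, Y j, Z k}"]) auto
  qed
qed

theorem theorem2p1:
  fixes n :: nat
  assumes "n \<ge> 1"
  shows "minimally_generates
    ({f1 i | i. 1 \<le> i \<and> i \<le> n}
     \<union> {f2 i j | i j. 1 \<le> i \<and> i < j \<and> j \<le> n}
     \<union> {g2 i j | i j. 1 \<le> i \<and> i \<le> j \<and> j \<le> n}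
     \<union> {g3 i j k | i j k. 1 \<le> i \<and> i < j \<and> j < k \<and> k \<le> n})
    (constants n :: (xyz, 'k::field_char_0) mpoly set)"
proof -
  have "\<not> generates T (constants n)" if T: "T \<subset> gens n" for T :: "(xyz, 'k) mpoly set"
  proof
    assume "generates T (constants n)"
    then have eq: "is_subalgebra hull T = gen_alg n"
      by (simp add: generates_def gen_alg_eq_constants)
    \<comment> \<open>The hull of \<open>T\<close> stays inside a subalgebra that excludes the
      missing generator \<open>s\<close>.\<close>
    obtain s where s: "s \<in> gens n" "s \<notin> T" using T by blast
    then obtain \<theta> S where B: "gens n - {s} \<subseteq> avoiding \<theta> S" "s \<notin> avoiding \<theta> S"
      using gens_minus_avoiding by blast
    have "is_subalgebra hull T \<subseteq> avoiding \<theta> S"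
      using B(1) T s(2) by (intro hull_minimal is_subalgebra_avoiding) auto
    moreover have "s \<in> is_subalgebra hull T"
      unfolding eq using s(1) hull_subset[of "gens n" is_subalgebra] by blast
    ultimately show False using B(2) by blast
  qed
  then have "minimally_generates (gens n) (constants n :: (xyz, 'k) mpoly set)"
    by (simp add: minimally_generates_def generates_def gen_alg_eq_constants)
  then show ?thesis by (simp only: gens_def)
qed

end
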